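(* Let $d\geq 1$, let $F\subseteq\mathbb{Z}^d$ be a finite configuration of $|F|=k\geq 3$ points, and let $\mu\in(0,\frac{k-1}{k})$ be real. Then there is a set of lattice points $X\subseteq\mathbb{N}^d$ such that (i) for every $r\geq 1$, every colouring of $X$ with $r$ colours contains a monochromatic homothetic copy of $F$, and (ii) every finite subset $Y\subseteq X$ has an $F$-free subset $Z\subseteq Y$ of size $|Z|\geq\mu|Y|$.
   Context: A homothetic copy of $F$ is a set $v+\lambda F=\{v+\lambda f\colon f\in F\}$ with $v\in\mathbb{Z}^d$ and $\lambda$ a positive integer. A set $Z\subseteq\mathbb{Z}^d$ is called $F$-free if there is no nonzero real number $\lambda$ such that $Z$ contains a congruent copy of $\lambda F$, i.e. a subset that is the image of $\lambda F=\{\lambda f\colon f\in F\}$ under an isometry of Euclidean space $\mathbb{R}^d$. *)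

theory Defs
  imports "HOL-Analysis.Analysis"
begin

text \<open>Lattice points of Z^d are vectors of type int^'d; the dimension d = CARD('d) \<ge> 1.\<close>

definition lattice_to_real :: "int ^ 'd \<Rightarrow> real ^ 'd" where
  "lattice_to_real x = (\<chi> i. real_of_int (x $ i))"

definition homothetic_copy :: "int ^ 'd \<Rightarrow> int \<Rightarrow> (int ^ 'd) set \<Rightarrow> (int ^ 'd) set" where
  "homothetic_copy v lam F = (\<lambda>f. (\<chi> i. v $ i + lam * f $ i)) ` F"

definition euclid_isometry :: "(real ^ 'd \<Rightarrow> real ^ 'd) \<Rightarrow> bool" where
  "euclid_isometry g \<longleftrightarrow> (\<forall>x y. dist (g x) (g y) = dist x y)"

definition F_free :: "(int ^ 'd) set \<Rightarrow> (int ^ 'd) set \<Rightarrow> bool" where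
  "F_free F Z \<longleftrightarrow> \<not> (\<exists>lam::real. lam \<noteq> 0 \<and> (\<exists>g. euclid_isometry g \<and>
      (\<lambda>f. g (lam *\<^sub>R lattice_to_real f)) ` F \<subseteq> lattice_to_real ` Z))"

end

theory Submission
  imports Defs "HOL-Library.Nat_Bijection" "HOL-Library.FuncSet" "HOL-Library.Ramsey"
    "HOL-Combinatorics.Permutations"
begin

text \<open>
  Let \<open>H\<close> be the \<open>k\<close>-uniform hypergraph whose vertices are increasing \<open>t\<close>-tuples of integers and whose
  edges consist of \<open>k\<close> consecutive windows of a longer increasing tuple. Ramsey's theorem makes its
  chromatic number large. On the other hand, order the integers by a random permutation and keep those
  tuples in which the position of the largest entry is neither divisible by \<open>k\<close> nor close to either
  end: no edge survives completely, because the position decreases by one from each window to the next,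
  while each tuple is kept with probability close to \<open>(k - 1) / k\<close>.

  The partite construction transfers this to the lattice. It starts with far apart translates of \<open>F\<close>,
  one for each edge of \<open>H\<close>, and makes the vertex classes monochromatic one after the other by a
  Hales-Jewett theorem over the current vertex class, keeping the property that every similar copy of
  \<open>F\<close> projects onto an edge of \<open>H\<close>. Hales-Jewett words are mapped to the lattice by weights so generic
  that every similar copy of \<open>F\<close> is, coordinate by coordinate, constant or a similar copy of \<open>F\<close>. For
  \<open>k = 3\<close> this would fail if three lines of the Hales-Jewett space could have active sets \<open>B \<union> C\<close>, \<open>B\<close> and \<open>C\<close>
  with \<open>B\<close> and \<open>C\<close> disjoint, so a sparse family of lines is used, obtained by running Shelah's proof with
  the triangle-free shift graph in place of a chain.
\<close>

section \<open>A sparse Hales-Jewett theorem\<close>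

text \<open>Encodes the vertex \<open>(i, j)\<close> of the shift graph as a set of pairs, so that
  every edge from \<open>(i, j)\<close> to \<open>(j, l)\<close> becomes a proper inclusion. These
  inclusions replace the pairs of initial segments of a chain in Shelah's proof.\<close>

definition shift_set :: "nat \<Rightarrow> nat \<Rightarrow> (nat \<times> nat) set" where
  "shift_set i j = insert (i, j) {(a, b). a < b \<and> b \<le> i}"

definition shift_edges :: "nat \<Rightarrow> ((nat \<times> nat) set \<times> (nat \<times> nat) set) set" where
  "shift_edges m = {(shift_set i j, shift_set j l) | i j l. i < j \<and> j < l \<and> l \<le> m}"

lemma shift_edges_finite: "finite (shift_edges m)"
proof -
  have "shift_edges m \<subseteq> (\<lambda>(i, j, l). (shift_set i j, shift_set j l)) ` ({..m} \<times> {..m} \<times> {..m})"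
  proof
    fix e assume "e \<in> shift_edges m"
    then obtain i j l where "e = (shift_set i j, shift_set j l)" "i < j" "j < l" "l \<le> m"
      unfolding shift_edges_def by blast
    then show "e \<in> (\<lambda>(i, j, l). (shift_set i j, shift_set j l)) ` ({..m} \<times> {..m} \<times> {..m})"
      by (intro image_eqI[where x="(i, j, l)"]) auto
  qed
  then show ?thesis
    by (rule finite_subset) simp
qed

lemma shift_edges_subset:
  assumes "(C, C') \<in> shift_edges m"
  shows "C \<subset> C'" "C' \<subseteq> {..m} \<times> {..m}"
proof -
  obtain i j l where ijl: "C = shift_set i j" "C' = shift_set j l" "i < j" "j < l" "l \<le> m"
    using assms unfolding shift_edges_def by auto
  have "C \<subseteq> C'" using ijl by (auto simp: shift_set_def)
  moreover have "(j, l) \<in> C' - C" using ijl by (auto simp: shift_set_def)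
  ultimately show "C \<subset> C'" by blast
  show "C' \<subseteq> {..m} \<times> {..m}" using ijl by (auto simp: shift_set_def)
qed

text \<open>The pair \<open>(i, j)\<close> lies in \<open>shift_set i' j'\<close> only if the pairs
  agree or \<open>j \<le> i'\<close>, so one edge is never nested strictly inside another. If all
  pairs of a chain were edges, this would fail.\<close>

lemma shift_edges_cover:
  assumes "(C, C') \<in> shift_edges m" "(D, D') \<in> shift_edges m" "C \<subseteq> D" "D' \<subseteq> C'"
  shows "D = C \<and> D' = C'"
proof -
  obtain i j l where ijl: "C = shift_set i j" "C' = shift_set j l" "i < j" "j < l"
    using assms(1) unfolding shift_edges_def by auto
  obtain i' j' l' where ijl': "D = shift_set i' j'" "D' = shift_set j' l'" "i' < j'" "j' < l'"
    using assms(2) unfolding shift_edges_def by auto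
  have "(i, j) \<in> shift_set i' j'" "(j', l') \<in> shift_set j l"
    using assms(3,4) ijl ijl' by (auto simp: shift_set_def)
  then show ?thesis
    using ijl ijl' by (auto simp: shift_set_def)
qed

text \<open>If no edge were monochromatic, the sets of colours leaving the indices
  \<open>0, \<dots>, 2 ^ R\<close> would be pairwise distinct subsets of a set with at most \<open>R\<close> elements.\<close>

lemma shift_edges_monochromatic:
  fixes col :: "(nat \<times> nat) set \<Rightarrow> 'c"
  assumes S: "finite S" "card S \<le> R" and col: "\<And>C. col C \<in> S"
  shows "\<exists>C C'. (C, C') \<in> shift_edges (2 ^ R + 1) \<and> col C = col C'"
proof (rule ccontr)
  assume no: "\<not> ?thesis"
  let ?M = "2 ^ R + 1 :: nat"
  define out where "out i = {col (shift_set i j) | j. i < j \<and> j \<le> ?M}" for i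
  have ne: "col (shift_set i j) \<noteq> col (shift_set j l)" if "i < j" "j < l" "l \<le> ?M" for i j l
    using that no unfolding shift_edges_def by blast
  have "out i \<noteq> out j" if "i < j" "j \<le> 2 ^ R" for i j
  proof -
    have "col (shift_set i j) \<in> out i" using that unfolding out_def by auto
    \<comment> \<open>A colour in \<open>out j\<close> belongs to some \<open>(j, l)\<close>, which
      would form a monochromatic edge with \<open>(i, j)\<close>.\<close>
    moreover have "col (shift_set i j) \<notin> out j" using ne that unfolding out_def by auto
    ultimately show ?thesis by blast
  qed
  then have "inj_on out {..2 ^ R}"
    by (intro linorder_inj_onI) auto
  moreover have "out ` {..2 ^ R} \<subseteq> Pow S"
    using col unfolding out_def by auto
  ultimately have "card {..(2 ^ R :: nat)} \<le> card (Pow S)"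
    using S(1) by (metis card_inj_on_le finite_Pow_iff)
  also have "\<dots> \<le> 2 ^ R"
    using S by (simp add: card_Pow power_increasing)
  finally show False by simp
qed

text \<open>A combinatorial line inside one block with active set \<open>snd e - fst e\<close>. For
  nested \<open>e\<close> the letter \<open>p\<close> yields the word marking \<open>snd e\<close>
  and \<open>q\<close> the word marking \<open>fst e\<close>, so exchanging them moves along an edge
  of the shift graph.\<close>

definition gword :: "'b \<Rightarrow> 'b \<Rightarrow> (nat \<times> nat) set \<times> (nat \<times> nat) set \<Rightarrow> 'b \<Rightarrow> nat \<times> nat \<Rightarrow> 'b" where
  "gword p q e a x = (if x \<in> fst e then p else if x \<in> snd e then a else q)"

definition gwords ::
  "'b \<Rightarrow> 'b \<Rightarrow> nat set \<Rightarrow> (nat \<Rightarrow> (nat \<times> nat) set \<times> (nat \<times> nat) set) \<Rightarrow> (nat \<Rightarrow> 'b) \<Rightarrow> nat \<Rightarrow> nat \<times> nat \<Rightarrow> 'b"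
  where "gwords p q I E w i = (if i \<in> I then gword p q (E i) (w i) else (\<lambda>_. q))"

lemma gwords_cong:
  assumes "\<And>i. i \<in> I \<Longrightarrow> E i = E' i" "\<And>i. i \<in> I \<Longrightarrow> w i = w' i"
  shows "gwords p q I E w = gwords p q I E' w'"
  using assms by (auto simp: gwords_def fun_eq_iff)

lemma gwords_insert:
  "j \<notin> I \<Longrightarrow> gwords p q (insert j I) E w = (gwords p q I E w)(j := gword p q (E j) (w j))"
  by (auto simp: gwords_def fun_eq_iff)

lemma gwords_values:
  "\<lbrakk>p \<in> A; q \<in> A; \<And>i. i \<in> I \<Longrightarrow> w i \<in> A\<rbrakk> \<Longrightarrow> gwords p q I E w i x \<in> A"
  by (auto simp: gwords_def gword_def)

lemma finite_gwords:
  fixes A :: "'b set"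
  assumes "finite I" "finite A"
  shows "finite {gwords p q I E w | E w. (\<forall>i\<in>I. E i \<in> shift_edges (R i)) \<and> (\<forall>i\<in>I. w i \<in> A)}"
    (is "finite ?U")
proof -
  have "?U \<subseteq> (\<lambda>(E, w). gwords p q I E w) ` (PiE I (\<lambda>i. shift_edges (R i)) \<times> PiE I (\<lambda>_. A))"
  proof
    fix u assume "u \<in> ?U"
    then obtain E w where u: "u = gwords p q I E w" "\<forall>i\<in>I. E i \<in> shift_edges (R i)" "\<forall>i\<in>I. w i \<in> A"
      by blast
    have "u = gwords p q I (restrict E I) (restrict w I)"
      unfolding u(1) by (rule gwords_cong) auto
    then show "u \<in> (\<lambda>(E, w). gwords p q I E w) ` (PiE I (\<lambda>i. shift_edges (R i)) \<times> PiE I (\<lambda>_. A))"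
      using u by (intro image_eqI[where x="(restrict E I, restrict w I)"]) auto
  qed
  moreover have "finite (PiE I (\<lambda>i. shift_edges (R i)) \<times> PiE I (\<lambda>_. A))"
    using assms by (intro finite_cartesian_product finite_PiE) (auto simp: shift_edges_finite)
  ultimately show ?thesis
    by (meson finite_imageI finite_subset)
qed

text \<open>Shelah's argument: a vertex of the shift graph placed in coordinate \<open>j\<close> is coloured by the function
  it induces on all words over the remaining coordinates.\<close>

lemma interchangeable_letters:
  fixes A :: "'b set" and I :: "nat set"
  assumes "finite I" and A: "finite A" "p \<in> A" "q \<in> A"
  shows "\<exists>R. \<forall>col :: (nat \<Rightarrow> nat \<times> nat \<Rightarrow> 'b) \<Rightarrow> nat.
    (\<forall>u. (\<forall>i x. u i x \<in> A) \<longrightarrow> col u < r) \<longrightarrow>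
    (\<exists>E. (\<forall>i\<in>I. E i \<in> shift_edges (R i)) \<and>
      (\<forall>j\<in>I. \<forall>w. (\<forall>i\<in>I. w i \<in> A) \<longrightarrow>
        col (gwords p q I E (w(j := p))) = col (gwords p q I E (w(j := q)))))"
  using assms(1)
proof (induction I arbitrary: r rule: finite_induct)
  case empty
  then show ?case by auto
next
  case (insert j I)
  \<comment> \<open>Maps from letters to colours; each serves as a single colour when the induction
    hypothesis is applied.\<close>
  define cols where "cols = PiE A (\<lambda>_. {..<r})"
  have fin_cols: "finite cols" unfolding cols_def using A by (intro finite_PiE) auto
  then obtain enc :: "('b \<Rightarrow> nat) \<Rightarrow> nat" where enc: "bij_betw enc cols {0..<card cols}"
    using ex_bij_betw_finite_nat by blast
  obtain R where R: "\<And>col :: (nat \<Rightarrow> nat \<times> nat \<Rightarrow> 'b) \<Rightarrow> nat.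
    (\<forall>u. (\<forall>i x. u i x \<in> A) \<longrightarrow> col u < card cols) \<Longrightarrow>
    (\<exists>E. (\<forall>i\<in>I. E i \<in> shift_edges (R i)) \<and>
      (\<forall>j\<in>I. \<forall>w. (\<forall>i\<in>I. w i \<in> A) \<longrightarrow>
        col (gwords p q I E (w(j := p))) = col (gwords p q I E (w(j := q)))))"
    using insert.IH[of "card cols"] by blast
  \<comment> \<open>All words over the blocks in \<open>I\<close> that the sizes \<open>R\<close>
    permit. Their number bounds the colours of the shift graph in block \<open>j\<close>, so
    \<open>R\<close> is fixed before the size of that block.\<close>
  define U where "U = {gwords p q I E w | E w. (\<forall>i\<in>I. E i \<in> shift_edges (R i)) \<and> (\<forall>i\<in>I. w i \<in> A)}"
  have fin_U: "finite U" unfolding U_def by (rule finite_gwords[OF insert.hyps(1) A(1)])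
  have U_A: "u i x \<in> A" if "u \<in> U" for u i x
    using that A unfolding U_def by (auto intro!: gwords_values)
  define S where "S = PiE U (\<lambda>_. {..<r})"
  have fin_S: "finite S" unfolding S_def using fin_U by (intro finite_PiE) auto
  define R' where "R' = R(j := 2 ^ card S + 1)"
  show ?case
  proof (rule exI[of _ R'], intro allI impI)
    fix col :: "(nat \<Rightarrow> nat \<times> nat \<Rightarrow> 'b) \<Rightarrow> nat"
    assume col: "\<forall>u. (\<forall>i x. u i x \<in> A) \<longrightarrow> col u < r"
    define vcol where "vcol C = (\<lambda>u\<in>U. col (u(j := (\<lambda>x. if x \<in> C then p else q))))" for C
    have "vcol C \<in> S" for C
      unfolding vcol_def S_def using U_A A col by auto
    then obtain C C' where e: "(C, C') \<in> shift_edges (2 ^ card S + 1)" "vcol C = vcol C'"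
      using shift_edges_monochromatic[OF fin_S order_refl, of vcol] by blast
    let ?e = "(C, C')"
    have sub: "C \<subset> C'" using shift_edges_subset e by blast
    have pe: "gword p q ?e p = (\<lambda>x. if x \<in> C' then p else q)"
      and qe: "gword p q ?e q = (\<lambda>x. if x \<in> C then p else q)"
      using sub by (auto simp: gword_def fun_eq_iff)
    have swap: "col (u(j := gword p q ?e p)) = col (u(j := gword p q ?e q))" if "u \<in> U" for u
      using fun_cong[OF e(2), of u] that by (simp add: vcol_def pe qe)
    \<comment> \<open>With the edge of block \<open>j\<close> fixed, a word over the other blocks is
      coloured by the whole map from the letter in block \<open>j\<close> to the resulting
      colour.\<close>
    define col' where "col' u = enc (\<lambda>a\<in>A. col (u(j := gword p q ?e a)))" for u
    have in_cols: "(\<lambda>a\<in>A. col (u(j := gword p q ?e a))) \<in> cols" if "\<forall>i x. u i x \<in> A" for u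
      using that A col unfolding cols_def by (auto simp: gword_def)
    have "\<forall>u. (\<forall>i x. u i x \<in> A) \<longrightarrow> col' u < card cols"
      unfolding col'_def using in_cols bij_betwE[OF enc] by fastforce
    from R[OF this] obtain E where E: "\<forall>i\<in>I. E i \<in> shift_edges (R i)"
      "\<And>i w. i \<in> I \<Longrightarrow> (\<forall>i\<in>I. w i \<in> A) \<Longrightarrow>
        col' (gwords p q I E (w(i := p))) = col' (gwords p q I E (w(i := q)))" by blast
    let ?E = "E(j := ?e)"
    have ins: "gwords p q (insert j I) ?E w = (gwords p q I E w)(j := gword p q ?e (w j))" for w
      using gwords_insert[OF insert.hyps(2), of p q ?E w] gwords_cong[of I ?E E w w] insert.hyps(2)
      by (metis fun_upd_other fun_upd_same)
    show "\<exists>E. (\<forall>i\<in>insert j I. E i \<in> shift_edges (R' i)) \<and>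
      (\<forall>i\<in>insert j I. \<forall>w. (\<forall>i\<in>insert j I. w i \<in> A) \<longrightarrow>
        col (gwords p q (insert j I) E (w(i := p))) = col (gwords p q (insert j I) E (w(i := q))))"
    proof (rule exI[of _ ?E], intro conjI ballI allI impI)
      fix i assume "i \<in> insert j I"
      then show "?E i \<in> shift_edges (R' i)"
        using E e insert.hyps(2) by (auto simp: R'_def)
    next
      fix i w assume i: "i \<in> insert j I" and w: "\<forall>i\<in>insert j I. w i \<in> A"
      show "col (gwords p q (insert j I) ?E (w(i := p))) = col (gwords p q (insert j I) ?E (w(i := q)))"
      \<comment> \<open>In block \<open>j\<close> the exchange is the choice of the edge; in the
        other blocks it is the induction hypothesis for \<open>col'\<close>, evaluated at the letter
        \<open>w j\<close>.\<close>
      proof (cases "i = j")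
        case True
        have "gwords p q I E w \<in> U" using E w unfolding U_def by blast
        moreover have "gwords p q I E (w(j := a)) = gwords p q I E w" for a
          using insert.hyps(2) by (intro gwords_cong) auto
        ultimately show ?thesis using True swap by (simp add: ins)
      next
        case False
        then have iI: "i \<in> I" using i by blast
        let ?u = "\<lambda>a. gwords p q I E (w(i := a))"
        have "\<forall>i x. ?u a i x \<in> A" if "a \<in> A" for a
          using that w A by (auto intro!: gwords_values)
        then have "(\<lambda>a\<in>A. col ((?u p)(j := gword p q ?e a))) = (\<lambda>a\<in>A. col ((?u q)(j := gword p q ?e a)))"
          using E(2)[OF iI, of w] w A in_cols[of "?u p"] in_cols[of "?u q"]
          unfolding col'_def by (intro inj_onD[OF bij_betw_imp_inj_on[OF enc]]) auto
        from fun_cong[OF this, of "w j"] show ?thesis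
          using w False by (simp add: ins)
      qed
    qed
  qed
qed

section \<open>Combinatorial lines and their conflicts\<close>

definition subst_line :: "(nat \<Rightarrow> 'b option) \<Rightarrow> 'b \<Rightarrow> nat \<Rightarrow> 'b" where
  "subst_line l a i = (case l i of None \<Rightarrow> a | Some b \<Rightarrow> b)"

text \<open>The active sets of \<open>l2\<close> and \<open>l3\<close> are nonempty and partition that of \<open>l1\<close>.\<close>

definition conflict :: "nat set \<Rightarrow> (nat \<Rightarrow> 'b option) \<Rightarrow> (nat \<Rightarrow> 'b option) \<Rightarrow> (nat \<Rightarrow> 'b option) \<Rightarrow> bool" where
  "conflict I l1 l2 l3 \<longleftrightarrow>
    (\<forall>i\<in>I. l1 i \<noteq> None \<and> l2 i = l1 i \<and> l3 i = l1 i \<or> l1 i = None \<and> (l2 i = None \<longleftrightarrow> l3 i \<noteq> None)) \<and>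
    (\<exists>i\<in>I. l1 i = None \<and> l2 i \<noteq> None) \<and> (\<exists>i\<in>I. l1 i = None \<and> l3 i \<noteq> None)"

definition line_over :: "nat set \<Rightarrow> 'b set \<Rightarrow> (nat \<Rightarrow> 'b option) \<Rightarrow> bool" where
  "line_over I A l \<longleftrightarrow> (\<forall>i\<in>I. \<forall>a. l i = Some a \<longrightarrow> a \<in> A) \<and> (\<exists>i\<in>I. l i = None)"

text \<open>Flattens the blocks into one sequence of coordinates by nested pairing: block index
  first, then the pair inside the block. An active coordinate of \<open>l\<close> spreads over the
  active set of its block.\<close>

definition gline ::
  "'b \<Rightarrow> 'b \<Rightarrow> nat set \<Rightarrow> (nat \<Rightarrow> (nat \<times> nat) set \<times> (nat \<times> nat) set) \<Rightarrow> (nat \<Rightarrow> 'b option) \<Rightarrow> nat \<Rightarrow> 'b option"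
  where "gline p q I E l n = (case prod_decode n of (i, y) \<Rightarrow>
    gwords (Some p) (Some q) I E l i (prod_decode y))"

lemma subst_gline:
  "subst_line (gline p q I E l) a =
    (\<lambda>n. gwords p q I E (subst_line l a) (fst (prod_decode n)) (prod_decode (snd (prod_decode n))))"
  by (auto simp: fun_eq_iff subst_line_def gline_def gwords_def gword_def split: prod.splits)

lemma gline_eq: "gline p q I E l (prod_encode (i, prod_encode x)) = gwords (Some p) (Some q) I E l i x"
  by (simp add: gline_def)

text \<open>The lines are compared block by block. Where \<open>l1\<close> has a letter, its block
  has no wildcard, and \<open>l2\<close> and \<open>l3\<close> carry the same letter. Where
  \<open>l1\<close> is active, exactly one of \<open>l2\<close> and \<open>l3\<close> is: two
  letters would leave its wildcards uncovered, while two active blocks would have the same edge as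
  \<open>l1\<close> by \<open>shift_edges_cover\<close>, so the wildcards would coincide instead of
  forming a partition.\<close>

lemma gline_conflict:
  assumes pq: "p \<notin> A" "q \<in> A"
    and L: "\<And>i. i \<in> I \<Longrightarrow> E1 i \<in> shift_edges (R i)" "\<And>i. i \<in> I \<Longrightarrow> E2 i \<in> shift_edges (R i)"
      "\<And>i. i \<in> I \<Longrightarrow> E3 i \<in> shift_edges (R i)"
    and l: "line_over I A l1" "line_over I A l2" "line_over I A l3"
    and J: "J = (\<lambda>(i, x). prod_encode (i, prod_encode x)) ` (SIGMA i:I. {..R i} \<times> {..R i})"
    and con: "conflict J (gline p q I E1 l1) (gline p q I E2 l2) (gline p q I E3 l3)"
  shows "conflict I l1 l2 l3"
proof -
  let ?g = "\<lambda>E l i. gword (Some p) (Some q) (E i) (l i)"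
  let ?pat = "\<lambda>o1 o2 o3. o1 \<noteq> None \<and> o2 = o1 \<and> o3 = o1 \<or> o1 = None \<and> (o2 = None \<longleftrightarrow> o3 \<noteq> None)"
  have sub: "fst e \<subset> snd e" "snd e \<subseteq> {..m} \<times> {..m}" if "e \<in> shift_edges m" for e m
    using shift_edges_subset[of "fst e" "snd e"] that by auto
  have pat_in: "?pat (?g E1 l1 i x) (?g E2 l2 i x) (?g E3 l3 i x)"
    if "i \<in> I" "x \<in> {..R i} \<times> {..R i}" for i x
  proof -
    have "prod_encode (i, prod_encode x) \<in> J"
      unfolding J using that by (intro image_eqI[where x="(i, x)"]) auto
    with con have "?pat (gline p q I E1 l1 (prod_encode (i, prod_encode x)))
        (gline p q I E2 l2 (prod_encode (i, prod_encode x))) (gline p q I E3 l3 (prod_encode (i, prod_encode x)))"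
      unfolding conflict_def by (elim conjE) (rule bspec)
    then show ?thesis using that(1) unfolding gline_eq gwords_def by simp
  qed
  \<comment> \<open>Outside the box all three lines show \<open>Some q\<close>, so the pattern
    extends to every coordinate of the block.\<close>
  have pat: "?pat (?g E1 l1 i x) (?g E2 l2 i x) (?g E3 l3 i x)" if i: "i \<in> I" for i x
  proof (cases "x \<in> {..R i} \<times> {..R i}")
    case False
    then show ?thesis
      using sub[OF L(1)[OF i]] sub[OF L(2)[OF i]] sub[OF L(3)[OF i]] unfolding gword_def by auto
  next
    case True
    then show ?thesis by (rule pat_in[OF i])
  qed
  \<comment> \<open>A letter of \<open>A\<close> differs from \<open>p\<close>, so in the active set
    of its block it is matched only by the other letter or by \<open>q\<close>. One test coordinate
    from each block then suffices.\<close>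
  have letters: "l1 i = l2 i"
    if i: "i \<in> I" and some: "l1 i \<noteq> None" "l2 i \<noteq> None"
      and l: "line_over I A l1" "line_over I A l2" and L: "E1 i \<in> shift_edges (R i)" "E2 i \<in> shift_edges (R i)"
      and eq: "\<And>x. ?g E1 l1 i x = ?g E2 l2 i x" for i l1 l2 E1 E2
  proof -
    obtain c1 c2 where c: "l1 i = Some c1" "l2 i = Some c2" using some by auto
    have cA: "c1 \<in> A" "c2 \<in> A" using l i c unfolding line_over_def by auto
    obtain x1 where x1: "x1 \<in> snd (E1 i) - fst (E1 i)" using sub L by blast
    obtain x2 where x2: "x2 \<in> snd (E2 i) - fst (E2 i)" using sub L by blast
    show ?thesis using eq[of x1] eq[of x2] x1 x2 c cA pq
      by (auto simp: gword_def split: if_splits)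
  qed
  have case_none: "l2 i = None \<longleftrightarrow> l3 i \<noteq> None" if i: "i \<in> I" and n: "l1 i = None" for i
  proof -
    obtain x1 where x1: "x1 \<in> snd (E1 i) - fst (E1 i)" using sub L i by blast
    have x1n: "?g E1 l1 i x1 = None" using x1 n by (simp add: gword_def)
    have not_both: False if "l2 i = None" "l3 i = None"
    proof -
      \<comment> \<open>Agreement with \<open>l1\<close> off its wildcards nests the edge
        \<open>E i\<close> inside \<open>E1 i\<close>: the \<open>p\<close> part can only grow and
        the \<open>q\<close> part can only grow.\<close>
      have cov: "E i = E1 i"
        if E: "E i \<in> shift_edges (R i)" and "l i = None"
          and none: "\<And>x. ?g E1 l1 i x \<noteq> None \<Longrightarrow> ?g E l i x = ?g E1 l1 i x" for E l
      proof -
        have "fst (E1 i) \<subseteq> fst (E i)"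
        proof
          fix x assume "x \<in> fst (E1 i)"
          then have "?g E l i x = Some p" using none[of x] by (simp add: gword_def)
          then show "x \<in> fst (E i)" using pq that(2) by (auto simp: gword_def split: if_splits)
        qed
        moreover have "snd (E i) \<subseteq> snd (E1 i)"
        proof
          fix x assume x: "x \<in> snd (E i)"
          show "x \<in> snd (E1 i)"
          proof (rule ccontr)
            assume "x \<notin> snd (E1 i)"
            moreover have "x \<notin> fst (E1 i)" using calculation sub[OF L(1)[OF i]] by blast
            ultimately have "?g E l i x = Some q" using none[of x] by (simp add: gword_def)
            then show False using x pq that(2) by (auto simp: gword_def split: if_splits)
          qed
        qed
        ultimately show ?thesis
          using shift_edges_cover[of "fst (E1 i)" "snd (E1 i)" "R i" "fst (E i)" "snd (E i)"] E L(1)[OF i]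
          by (simp add: prod_eq_iff)
      qed
      have same: "?g E2 l2 i x = ?g E1 l1 i x" "?g E3 l3 i x = ?g E1 l1 i x"
        if "?g E1 l1 i x \<noteq> None" for x
        using pat[OF i, of x] that by blast+
      have "E2 i = E1 i" using cov[of E2 l2] L(2)[OF i] that(1) same(1) by blast
      moreover have "E3 i = E1 i" using cov[of E3 l3] L(3)[OF i] that(2) same(2) by blast
      ultimately show False using pat[OF i, of x1] that n x1 by (auto simp: gword_def)
    qed
    moreover have False if "l2 i \<noteq> None" "l3 i \<noteq> None"
      using pat[OF i, of x1] x1n that by (auto simp: gword_def split: if_splits)
    ultimately show ?thesis by blast
  qed
  have case_some: "l2 i = l1 i \<and> l3 i = l1 i" if i: "i \<in> I" and n: "l1 i \<noteq> None" for i
  proof -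
    have eq: "?g E2 l2 i x = ?g E1 l1 i x" "?g E3 l3 i x = ?g E1 l1 i x" "?g E1 l1 i x \<noteq> None" for x
      using pat[OF i, of x] n by (auto simp: gword_def)
    obtain x2 where x2: "x2 \<in> snd (E2 i) - fst (E2 i)" using sub L i by blast
    obtain x3 where x3: "x3 \<in> snd (E3 i) - fst (E3 i)" using sub L i by blast
    have "l2 i \<noteq> None" using eq[of x2] x2 by (auto simp: gword_def)
    moreover have "l3 i \<noteq> None" using eq[of x3] x3 by (auto simp: gword_def)
    ultimately show ?thesis
      using letters[of i l1 l2 E1 E2] letters[of i l1 l3 E1 E3] i n l L(1,2,3)[OF i] eq by metis
  qed
  have ex: "\<exists>i\<in>I. l1 i = None \<and> l2 i \<noteq> None"
  proof -
    obtain i x where ix: "i \<in> I" "?g E1 l1 i x = None" "?g E2 l2 i x \<noteq> None"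
      using con unfolding conflict_def J by (auto simp: gline_eq gwords_def)
    have "?g E3 l3 i x = None" using pat[OF ix(1), of x] ix by auto
    then have "l3 i = None" "l1 i = None" using ix by (auto simp: gword_def split: if_splits)
    then show ?thesis using case_none ix(1) by blast
  qed
  have ex': "\<exists>i\<in>I. l1 i = None \<and> l3 i \<noteq> None"
  proof -
    obtain i x where ix: "i \<in> I" "?g E1 l1 i x = None" "?g E3 l3 i x \<noteq> None"
      using con unfolding conflict_def J by (auto simp: gline_eq gwords_def)
    have "?g E2 l2 i x = None" using pat[OF ix(1), of x] ix by auto
    then have "l2 i = None" "l1 i = None" using ix by (auto simp: gword_def split: if_splits)
    then show ?thesis using case_none ix(1) by blast
  qed
  show ?thesis
    unfolding conflict_def
  proof (intro conjI ballI ex ex')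
    fix i assume "i \<in> I"
    then show "?pat (l1 i) (l2 i) (l3 i)"
      using case_none[of i] case_some[of i] by (cases "l1 i = None") simp_all
  qed
qed

definition sparse_HJ :: "nat \<Rightarrow> 'b set \<Rightarrow> nat set \<Rightarrow> (nat \<Rightarrow> 'b option) set \<Rightarrow> bool" where
  "sparse_HJ r A I L \<longleftrightarrow> finite I \<and> finite L \<and> (\<forall>l\<in>L. line_over I A l) \<and>
    (\<forall>l1\<in>L. \<forall>l2\<in>L. \<forall>l3\<in>L. \<not> conflict I l1 l2 l3) \<and>
    (\<forall>col :: (nat \<Rightarrow> 'b) \<Rightarrow> nat. (\<forall>w. (\<forall>i\<in>I. w i \<in> A) \<longrightarrow> col w < r) \<longrightarrow>
      (\<exists>l\<in>L. \<forall>a\<in>A. \<forall>b\<in>A. col (subst_line l a) = col (subst_line l b)))"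

text \<open>Induction on the alphabet. The new letter \<open>p\<close> is made interchangeable with
  an old letter \<open>q\<close> in each old coordinate, so a line monochromatic for the old letters
  is monochromatic for \<open>p\<close> too. A conflict of new lines would descend to the old
  ones.\<close>

theorem sparse_Hales_Jewett:
  fixes A :: "'b set"
  assumes "finite A" "A \<noteq> {}"
  shows "\<exists>I L. sparse_HJ r A I L"
  using assms
proof (induction A rule: finite_ne_induct)
  case (singleton a)
  show ?case
    by (rule exI[of _ "{0}"], rule exI[of _ "{\<lambda>_. None}"]) (auto simp: sparse_HJ_def line_over_def conflict_def)
next
  case (insert p A)
  obtain q where q: "q \<in> A" using insert.hyps by blast
  have pq: "p \<noteq> q" using q insert.hyps by blast
  obtain I L where sys: "sparse_HJ r A I L"
    using insert.IH by blast
  have IL: "finite I" "\<And>l. l \<in> L \<Longrightarrow> line_over I A l"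
    "\<And>l1 l2 l3. l1 \<in> L \<Longrightarrow> l2 \<in> L \<Longrightarrow> l3 \<in> L \<Longrightarrow> \<not> conflict I l1 l2 l3" "finite L"
    "\<And>col :: (nat \<Rightarrow> 'b) \<Rightarrow> nat. (\<forall>w. (\<forall>i\<in>I. w i \<in> A) \<longrightarrow> col w < r) \<Longrightarrow>
      \<exists>l\<in>L. \<forall>a\<in>A. \<forall>b\<in>A. col (subst_line l a) = col (subst_line l b)"
    using sys unfolding sparse_HJ_def by blast+
  obtain R where R: "\<And>col :: (nat \<Rightarrow> nat \<times> nat \<Rightarrow> 'b) \<Rightarrow> nat.
    (\<forall>u. (\<forall>i x. u i x \<in> insert p A) \<longrightarrow> col u < r) \<Longrightarrow>
    \<exists>E. (\<forall>i\<in>I. E i \<in> shift_edges (R i)) \<and>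
      (\<forall>j\<in>I. \<forall>w. (\<forall>i\<in>I. w i \<in> insert p A) \<longrightarrow>
        col (gwords p q I E (w(j := p))) = col (gwords p q I E (w(j := q))))"
    using interchangeable_letters[OF IL(1), of "insert p A" p q r] insert.hyps q by auto
  define J where "J = (\<lambda>(i, x). prod_encode (i, prod_encode x)) ` (SIGMA i:I. {..R i} \<times> {..R i})"
  define M where "M = (\<lambda>(E, l). gline p q I E l) ` (PiE I (\<lambda>i. shift_edges (R i)) \<times> L)"
  have finM: "finite M"
    unfolding M_def using IL(1,4)
    by (intro finite_imageI finite_cartesian_product finite_PiE) (auto simp: shift_edges_finite)
  have finJ: "finite J" unfolding J_def using IL(1) by auto
  have M_E: "\<exists>E l'. l = gline p q I E l' \<and> (\<forall>i\<in>I. E i \<in> shift_edges (R i)) \<and> l' \<in> L"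
    if lM: "l \<in> M" for l
  proof -
    from lM obtain E l' where "l = gline p q I E l'" "E \<in> PiE I (\<lambda>i. shift_edges (R i))" "l' \<in> L"
      unfolding M_def by auto
    then show ?thesis using PiE_mem by blast
  qed
  have lines: "line_over J (insert p A) l" if lM: "l \<in> M" for l
  proof -
    obtain E l' where l: "l = gline p q I E l'" "\<And>i. i \<in> I \<Longrightarrow> E i \<in> shift_edges (R i)" "l' \<in> L"
      using M_E[OF lM] by blast
    have lo: "line_over I A l'" using IL l by blast
    then obtain i where i: "i \<in> I" "l' i = None" unfolding line_over_def by blast
    obtain x where x: "x \<in> snd (E i) - fst (E i)" "x \<in> {..R i} \<times> {..R i}"
      using shift_edges_subset[of "fst (E i)" "snd (E i)" "R i"] l(2)[OF i(1)] by auto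
    have "prod_encode (i, prod_encode x) \<in> J" using i x unfolding J_def by force
    moreover have "l (prod_encode (i, prod_encode x)) = None"
      using i x l by (simp add: gline_eq gwords_def gword_def)
    moreover have "a \<in> insert p A" if "n \<in> J" "l n = Some a" for n a
      using that lo q unfolding J_def l(1) line_over_def
      by (auto simp: gline_eq gwords_def gword_def split: if_splits)
    ultimately show ?thesis unfolding line_over_def by blast
  qed
  have noconf: "\<not> conflict J l1 l2 l3" if M: "l1 \<in> M" "l2 \<in> M" "l3 \<in> M" for l1 l2 l3
  proof -
    obtain E1 E2 E3 l1' l2' l3' where
      1: "l1 = gline p q I E1 l1'" "\<And>i. i \<in> I \<Longrightarrow> E1 i \<in> shift_edges (R i)" "l1' \<in> L" and
      2: "l2 = gline p q I E2 l2'" "\<And>i. i \<in> I \<Longrightarrow> E2 i \<in> shift_edges (R i)" "l2' \<in> L" and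
      3: "l3 = gline p q I E3 l3'" "\<And>i. i \<in> I \<Longrightarrow> E3 i \<in> shift_edges (R i)" "l3' \<in> L"
      using M_E[OF M(1)] M_E[OF M(2)] M_E[OF M(3)] by blast
    show ?thesis
      using gline_conflict[OF insert.hyps(3) q 1(2) 2(2) 3(2) IL(2)[OF 1(3)] IL(2)[OF 2(3)]
          IL(2)[OF 3(3)] J_def] IL(3)[OF 1(3) 2(3) 3(3)] 1(1) 2(1) 3(1) by blast
  qed
  have mono: "\<exists>l\<in>M. \<forall>a\<in>insert p A. \<forall>b\<in>insert p A. col (subst_line l a) = col (subst_line l b)"
    if col: "\<forall>w. (\<forall>i\<in>J. w i \<in> insert p A) \<longrightarrow> col w < r" for col :: "(nat \<Rightarrow> 'b) \<Rightarrow> nat"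
  proof -
    define flat :: "(nat \<Rightarrow> nat \<times> nat \<Rightarrow> 'b) \<Rightarrow> nat \<Rightarrow> 'b"
      where "flat u n = u (fst (prod_decode n)) (prod_decode (snd (prod_decode n)))" for u n
    have "\<forall>u. (\<forall>i x. u i x \<in> insert p A) \<longrightarrow> col (flat u) < r"
    proof (intro allI impI)
      fix u :: "nat \<Rightarrow> nat \<times> nat \<Rightarrow> 'b" assume "\<forall>i x. u i x \<in> insert p A"
      then have "\<forall>n\<in>J. flat u n \<in> insert p A" unfolding flat_def by blast
      then show "col (flat u) < r" using col by blast
    qed
    from R[OF this] obtain E where E: "\<And>i. i \<in> I \<Longrightarrow> E i \<in> shift_edges (R i)"
      and swap: "\<And>j w. j \<in> I \<Longrightarrow> (\<forall>i\<in>I. w i \<in> insert p A) \<Longrightarrow>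
        col (flat (gwords p q I E (w(j := p)))) = col (flat (gwords p q I E (w(j := q))))"
      by blast
    let ?c = "\<lambda>w. col (flat (gwords p q I E w))"
    have "\<forall>w. (\<forall>i\<in>I. w i \<in> A) \<longrightarrow> ?c w < r"
    proof (intro allI impI)
      fix w assume "\<forall>i\<in>I. w i \<in> A"
      then have "\<forall>n\<in>J. flat (gwords p q I E w) n \<in> insert p A"
        using q gwords_values[of p "insert p A" q I w E] unfolding flat_def by blast
      then show "?c w < r" using col by blast
    qed
    from IL(5)[OF this] obtain l where l: "l \<in> L"
      "\<And>a b. a \<in> A \<Longrightarrow> b \<in> A \<Longrightarrow> ?c (subst_line l a) = ?c (subst_line l b)" by blast
    have lA: "a \<in> A" if "i \<in> I" "l i = Some a" for i a
      using IL(2)[OF l(1)] that unfolding line_over_def by blast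
    \<comment> \<open>Active coordinates change from \<open>q\<close> to \<open>p\<close> one at a
      time; \<open>swap\<close> preserves the colour each time.\<close>
    have shift: "?c (\<lambda>i. if i \<in> K then p else subst_line l q i) = ?c (subst_line l q)"
      if "finite K" "K \<subseteq> {i\<in>I. l i = None}" for K
      using that
    proof (induction K rule: finite_induct)
      case (insert j K)
      let ?w = "\<lambda>i. if i \<in> K then p else subst_line l q i"
      have "?w(j := p) = (\<lambda>i. if i \<in> insert j K then p else subst_line l q i)" by auto
      moreover have "?w(j := q) = ?w" using insert by (auto simp: fun_eq_iff subst_line_def)
      moreover have "\<forall>i\<in>I. ?w i \<in> Set.insert p A"
        using lA q by (auto simp: subst_line_def split: option.splits)
      ultimately have "?c (\<lambda>i. if i \<in> insert j K then p else subst_line l q i) = ?c ?w"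
        using swap[of j ?w] insert.prems by auto
      then show ?case using insert by auto
    qed simp
    have "gwords p q I E (\<lambda>i. if i \<in> {i\<in>I. l i = None} then p else subst_line l q i)
        = gwords p q I E (subst_line l p)"
      by (rule gwords_cong) (auto simp: subst_line_def split: option.splits)
    then have "?c (subst_line l p) = ?c (subst_line l q)"
      using shift[of "{i\<in>I. l i = None}"] IL(1) by simp
    then have all: "?c (subst_line l a) = ?c (subst_line l q)" if "a \<in> insert p A" for a
      using that l(2)[OF _ q, of a] by (cases "a = p") simp_all
    let ?l = "gline p q I (restrict E I) l"
    have "?l \<in> M"
      unfolding M_def using E l(1) by (intro image_eqI[where x="(restrict E I, l)"]) simp_all
    moreover have "col (subst_line ?l a) = ?c (subst_line l a)" for a
    proof -
      have "gwords p q I (restrict E I) (subst_line l a) = gwords p q I E (subst_line l a)"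
        by (rule gwords_cong) auto
      then show ?thesis unfolding subst_gline flat_def by simp
    qed
    ultimately show ?thesis using all by (intro bexI[of _ ?l] ballI) simp_all
  qed
  show ?case
    unfolding sparse_HJ_def using finJ finM lines noconf mono
    by (intro exI[of _ J] exI[of _ M] conjI ballI allI impI) blast+
qed

section \<open>Similar copies and generic weights\<close>

definition ip :: "int ^ 'd \<Rightarrow> int ^ 'd \<Rightarrow> int" where
  "ip x y = (\<Sum>i\<in>UNIV. x $ i * y $ i)"

abbreviation nsq :: "int ^ 'd \<Rightarrow> int" where
  "nsq x \<equiv> ip x x"

lemma ip_commute: "ip x y = ip y x"
  by (simp add: ip_def mult.commute)

lemma ip_diff_left: "ip (x - y) z = ip x z - ip y z"
  by (simp add: ip_def left_diff_distrib sum_subtractf)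

lemma ip_diff_right: "ip z (x - y) = ip z x - ip z y"
  by (simp add: ip_def right_diff_distrib sum_subtractf)

lemma ip_scale: "ip (a *s x) (b *s y) = a * b * ip x y"
  by (simp add: ip_def sum_distrib_left mult_ac)

lemma ip_sum: "ip (\<Sum>i\<in>I. x i) (\<Sum>j\<in>J. y j) = (\<Sum>i\<in>I. \<Sum>j\<in>J. ip (x i) (y j))"
proof -
  have "ip (\<Sum>i\<in>I. x i) (\<Sum>j\<in>J. y j) = (\<Sum>c\<in>UNIV. \<Sum>i\<in>I. \<Sum>j\<in>J. x i $ c * y j $ c)"
    by (simp add: ip_def sum_product)
  also have "\<dots> = (\<Sum>i\<in>I. \<Sum>c\<in>UNIV. \<Sum>j\<in>J. x i $ c * y j $ c)"
    by (rule sum.swap)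
  also have "\<dots> = (\<Sum>i\<in>I. \<Sum>j\<in>J. ip (x i) (y j))"
    unfolding ip_def by (rule sum.cong[OF refl], rule sum.swap)
  finally show ?thesis .
qed

lemma nsq_nonneg: "nsq x \<ge> 0"
  by (simp add: ip_def sum_nonneg)

lemma nsq_eq_0_iff: "nsq x = 0 \<longleftrightarrow> x = 0"
  by (auto simp: ip_def sum_nonneg_eq_0_iff vec_eq_iff)

lemma nsq_pos_iff: "nsq x > 0 \<longleftrightarrow> x \<noteq> 0"
  using nsq_nonneg[of x] nsq_eq_0_iff[of x] by linarith

text \<open>Here \<open>s\<close> is the square of the similarity ratio.\<close>

definition similar :: "(int ^ 'd) set \<Rightarrow> (int ^ 'd \<Rightarrow> int ^ 'd) \<Rightarrow> bool" where
  "similar F z \<longleftrightarrow> (\<exists>s::real. s > 0 \<and> (\<forall>f\<in>F. \<forall>g\<in>F. real_of_int (nsq (z f - z g)) = s * real_of_int (nsq (f - g))))"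

lemma similar_inj: "similar F z \<Longrightarrow> inj_on z F"
proof (rule inj_onI)
  fix f g assume "similar F z" "f \<in> F" "g \<in> F" "z f = z g"
  then obtain s :: real where "s > 0" "0 = s * real_of_int (nsq (f - g))"
    unfolding similar_def by (metis diff_self nsq_eq_0_iff of_int_0)
  then show "f = g" using nsq_eq_0_iff[of "f - g"] by simp
qed

section \<open>Base-\<open>K\<close> expansions and generic weights\<close>

lemma sum_powers_eq_0:
  fixes q :: "nat \<Rightarrow> int" and K :: int
  assumes "finite E" "\<And>e. e \<in> E \<Longrightarrow> \<bar>q e\<bar> < K" "(\<Sum>e\<in>E. q e * K ^ e) = 0" "e \<in> E"
  shows "q e = 0"
proof (rule ccontr)
  assume ne: "q e \<noteq> 0"
  define E' where "E' = {e\<in>E. q e \<noteq> 0}"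
  have E': "finite E'" "E' \<noteq> {}" using assms ne by (auto simp: E'_def)
  define m where "m = Min E'"
  have m: "m \<in> E'" "\<And>e. e \<in> E' \<Longrightarrow> m \<le> e" using E' unfolding m_def by auto
  have K: "K > 0" using assms(2,4) by fastforce
  have "0 = (\<Sum>e\<in>E'. q e * K ^ e)"
    using assms(1,3) by (subst assms(3)[symmetric], intro sum.mono_neutral_right) (auto simp: E'_def)
  also have "\<dots> = q m * K ^ m + (\<Sum>e\<in>E' - {m}. q e * K ^ e)"
    using E' m by (simp add: sum.remove)
  also have "(\<Sum>e\<in>E' - {m}. q e * K ^ e) = (\<Sum>e\<in>E' - {m}. K ^ (m + 1) * (q e * K ^ (e - (m + 1))))"
  proof (rule sum.cong[OF refl])
    fix e assume "e \<in> E' - {m}"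
    then have "m + 1 \<le> e" using m(2)[of e] by auto
    then show "q e * K ^ e = K ^ (m + 1) * (q e * K ^ (e - (m + 1)))"
      by (metis le_add_diff_inverse mult.left_commute power_add)
  qed
  also have "\<dots> = K ^ (m + 1) * (\<Sum>e\<in>E' - {m}. q e * K ^ (e - (m + 1)))"
    by (simp only: sum_distrib_left)
  finally have "K ^ m * (q m + K * (\<Sum>e\<in>E' - {m}. q e * K ^ (e - (m + 1)))) = 0"
    by (simp add: algebra_simps)
  then have "q m + K * (\<Sum>e\<in>E' - {m}. q e * K ^ (e - (m + 1))) = 0"
    using K by (simp only: mult_eq_0_iff) auto
  then have "q m = K * - (\<Sum>e\<in>E' - {m}. q e * K ^ (e - (m + 1)))"
    by (simp add: eq_neg_iff_add_eq_0)
  \<comment> \<open>All other terms have larger exponents, so the lowest nonzero digit is a multiple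
    of \<open>K\<close>, although it is smaller than \<open>K\<close> in absolute value.\<close>
  then have "K dvd q m" by (rule dvdI)
  moreover have "q m \<noteq> 0" "\<bar>q m\<bar> < K" using m assms(2) by (auto simp: E'_def)
  ultimately show False using dvd_imp_le_int[of "q m" K] K by simp
qed

text \<open>Terms with equal exponents are collected into one digit first. The bound ranges over all
  subsets so that it covers every fibre of \<open>e\<close>.\<close>

lemma sum_powers_fibre_eq_0:
  fixes q :: "'i \<Rightarrow> int" and e :: "'i \<Rightarrow> nat" and K :: int
  assumes "finite T" "\<And>S. S \<subseteq> T \<Longrightarrow> \<bar>\<Sum>p\<in>S. q p\<bar> < K" "(\<Sum>p\<in>T. q p * K ^ e p) = 0"
  shows "(\<Sum>p | p \<in> T \<and> e p = m. q p) = 0"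
proof (cases "m \<in> e ` T")
  case True
  have "(\<Sum>m\<in>e ` T. (\<Sum>p | p \<in> T \<and> e p = m. q p) * K ^ m) = (\<Sum>m\<in>e ` T. \<Sum>p | p \<in> T \<and> e p = m. q p * K ^ e p)"
    by (rule sum.cong[OF refl]) (simp add: sum_distrib_right)
  also have "\<dots> = 0"
    using assms(3) sum.group[OF assms(1) finite_imageI[OF assms(1)] subset_refl, of "\<lambda>p. q p * K ^ e p" e]
    by (simp only:)
  finally show ?thesis
    using True assms(1)
    by (intro sum_powers_eq_0[of "e ` T" "\<lambda>m. \<Sum>p | p \<in> T \<and> e p = m. q p" K] assms(2)) blast+
next
  case False
  then have "{p. p \<in> T \<and> e p = m} = {}" by auto
  then show ?thesis by (simp only: sum.empty)
qed

text \<open>The sum lies strictly between \<open>3 ^ max a b\<close> and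
  \<open>3 ^ Suc (max a b)\<close>, which determines the larger exponent; cancelling its power
  determines the smaller one.\<close>

lemma sum_two_powers_of_3:
  fixes a b c d :: nat
  assumes "(3::nat) ^ a + 3 ^ b = 3 ^ c + 3 ^ d"
  shows "a = c \<and> b = d \<or> a = d \<and> b = c"
proof -
  have top: "max a b = max c d" if eq: "(3::nat) ^ a + 3 ^ b = 3 ^ c + 3 ^ d" for a b c d
  proof -
    have lower: "(3::nat) ^ max a b < 3 ^ a + 3 ^ b" for a b :: nat
      by (simp add: max_def)
    have upper: "(3::nat) ^ a + 3 ^ b < 3 ^ Suc (max a b)" for a b :: nat
    proof -
      have "(3::nat) ^ a \<le> 3 ^ max a b" "(3::nat) ^ b \<le> 3 ^ max a b" by (simp_all add: power_increasing)
      moreover have "(0::nat) < 3 ^ max a b" by simp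
      ultimately show ?thesis unfolding power_Suc by linarith
    qed
    have "(3::nat) ^ max a b < 3 ^ Suc (max c d)" "(3::nat) ^ max c d < 3 ^ Suc (max a b)"
      using lower[of a b] upper[of c d] lower[of c d] upper[of a b] eq by linarith+
    then have "max a b < Suc (max c d)" "max c d < Suc (max a b)"
      by (simp_all only: power_strict_increasing_iff one_less_numeral_iff semiring_norm)
    then show ?thesis by linarith
  qed
  have "max a b = max c d" by (rule top[OF assms])
  moreover have "(3::nat) ^ max a b + 3 ^ min a b = 3 ^ max c d + 3 ^ min c d"
    using assms by (auto simp: max_def min_def)
  ultimately have "(3::nat) ^ min a b = 3 ^ min c d" by simp
  then have "min a b = min c d" by simp
  then show ?thesis using \<open>max a b = max c d\<close> by (auto simp: max_def min_def split: if_splits)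
qed

text \<open>Sends a word of lattice points to one lattice point. Lines become homotheties, and inner
  products become expansions with exponents \<open>3 ^ i + 3 ^ j\<close>.\<close>

definition wval :: "int \<Rightarrow> nat set \<Rightarrow> (nat \<Rightarrow> int ^ 'd) \<Rightarrow> int ^ 'd" where
  "wval K I w = (\<Sum>i\<in>I. K ^ (3 ^ i) *s w i)"

lemma wval_diff: "wval K I w - wval K I w' = wval K I (\<lambda>i. w i - w' i)"
  by (simp add: wval_def sum_subtractf vector_ssub_ldistrib)

lemma ip_wval:
  "ip (wval K I u) (wval K I v) = (\<Sum>(i, j)\<in>I \<times> I. ip (u i) (v j) * K ^ (3 ^ i + 3 ^ j))"
  unfolding wval_def ip_sum ip_scale by (simp add: sum.cartesian_product power_add mult_ac)

text \<open>The exponents \<open>3 ^ i + 3 ^ j\<close> determine the unordered pair of \<open>i\<close> and \<open>j\<close>, so a quadratic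
  relation with coefficients small against \<open>K\<close> between weighted sums holds coefficientwise.\<close>

lemma symmetric_quadratic_eq_0:
  fixes q :: "nat \<Rightarrow> nat \<Rightarrow> int"
  assumes "finite I" and bd: "\<And>i j. i \<in> I \<Longrightarrow> j \<in> I \<Longrightarrow> \<bar>q i j\<bar> \<le> B"
    and K: "int (card I * card I) * B < K"
    and sym: "\<And>i j. q i j = q j i"
    and zero: "(\<Sum>(i, j)\<in>I \<times> I. q i j * K ^ (3 ^ i + 3 ^ j)) = 0"
    and ab: "a \<in> I" "b \<in> I"
  shows "q a b = 0"
proof -
  let ?q = "\<lambda>(i, j). q i j" and ?e = "\<lambda>(i, j). 3 ^ i + 3 ^ j :: nat"
  have B: "B \<ge> 0" using bd[OF ab] by linarith
  have "(\<Sum>p | p \<in> I \<times> I \<and> ?e p = 3 ^ a + 3 ^ b. ?q p) = 0"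
  proof (rule sum_powers_fibre_eq_0)
    show "finite (I \<times> I)" using assms(1) by simp
    show "(\<Sum>p\<in>I \<times> I. ?q p * K ^ ?e p) = 0" using zero by (simp add: case_prod_beta)
    fix S assume S: "S \<subseteq> I \<times> I"
    have "\<bar>\<Sum>p\<in>S. ?q p\<bar> \<le> (\<Sum>p\<in>S. B)"
      using S bd by (intro order.trans[OF sum_abs] sum_mono) auto
    also have "\<dots> \<le> int (card I * card I) * B"
      using card_mono[OF _ S] assms(1) B by (simp add: mult_right_mono card_cartesian_product flip: of_nat_mult)
    finally show "\<bar>\<Sum>p\<in>S. ?q p\<bar> < K" using K by linarith
  qed
  moreover have "{p. p \<in> I \<times> I \<and> ?e p = 3 ^ a + 3 ^ b} = {(a, b), (b, a)}"
    using ab sum_two_powers_of_3 by (auto simp: add.commute)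
  ultimately show ?thesis
    using sym[of a b] by (cases "a = b") auto
qed

text \<open>Each coordinate of the sum is an expansion with distinct exponents and digits smaller
  than \<open>K\<close> in absolute value.\<close>

lemma wval_inj:
  assumes "finite I" and bd: "\<And>i c. i \<in> I \<Longrightarrow> \<bar>u i $ c\<bar> < K" and zero: "wval K I u = 0" and "i \<in> I"
  shows "u i = 0"
proof -
  have inj: "inj_on (\<lambda>i::nat. 3 ^ i :: nat) I" by (auto simp: inj_on_def)
  have "u i $ c = 0" for c
  proof -
    have "(\<Sum>i\<in>I. u i $ c * K ^ (3 ^ i)) = 0"
      using arg_cong[OF zero, of "\<lambda>x. x $ c"] by (simp add: wval_def mult.commute)
    then have "(\<Sum>e\<in>(\<lambda>i. 3 ^ i) ` I. u (the_inv_into I (\<lambda>i. 3 ^ i :: nat) e) $ c * K ^ e) = 0"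
      by (subst sum.reindex[OF inj]) (simp add: the_inv_into_f_f[OF inj])
    then have "u (the_inv_into I (\<lambda>i. 3 ^ i :: nat) (3 ^ i)) $ c = 0"
      using assms(1,4) bd
      by (intro sum_powers_eq_0[of "(\<lambda>i. 3 ^ i) ` I" "\<lambda>e. u (the_inv_into I (\<lambda>i. 3 ^ i) e) $ c" K])
        (auto simp: the_inv_into_f_f[OF inj])
    then show ?thesis
      using assms(4) by (simp add: the_inv_into_f_f[OF inj])
  qed
  then show ?thesis by (simp add: vec_eq_iff)
qed

lemma abs_ip_le:
  fixes x y :: "int ^ 'd"
  assumes "\<And>c. \<bar>x $ c\<bar> \<le> b" "\<And>c. \<bar>y $ c\<bar> \<le> b"
  shows "\<bar>ip x y\<bar> \<le> int CARD('d) * b\<^sup>2"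
proof -
  have "0 \<le> b" using assms(1)[of undefined] by linarith
  then have "\<bar>x $ c * y $ c\<bar> \<le> b\<^sup>2" for c
    using assms unfolding abs_mult power2_eq_square by (intro mult_mono) auto
  then have "\<bar>ip x y\<bar> \<le> (\<Sum>c\<in>(UNIV :: 'd set). b\<^sup>2)"
    unfolding ip_def by (intro order.trans[OF sum_abs] sum_mono)
  then show ?thesis by simp
qed

text \<open>Comparison with one fixed pair \<open>f0\<close>, \<open>g0\<close> eliminates the real
  ratio. What remains is an integer quadratic relation between weighted sums, which for large
  \<open>K\<close> holds for each pair of coordinates separately.\<close>

lemma similar_wval:
  fixes F :: "(int ^ 'd) set" and w :: "int ^ 'd \<Rightarrow> nat \<Rightarrow> int ^ 'd"
  assumes sim: "similar F (\<lambda>f. wval K I (w f))" and I: "finite I"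
    and bd: "\<And>f i c. f \<in> F \<Longrightarrow> i \<in> I \<Longrightarrow> \<bar>w f i $ c\<bar> \<le> b"
    and m: "\<And>f g. f \<in> F \<Longrightarrow> g \<in> F \<Longrightarrow> nsq (f - g) \<le> m"
    and K: "int (card I * card I) * (2 * m * (int CARD('d) * (2 * b)\<^sup>2)) < K"
    and ij: "i \<in> I" "j \<in> I"
  shows "\<exists>c::real. \<forall>f\<in>F. \<forall>g\<in>F. real_of_int (ip (w f i - w g i) (w f j - w g j)) = c * real_of_int (nsq (f - g))"
proof (cases "\<exists>f0\<in>F. \<exists>g0\<in>F. f0 \<noteq> g0")
  case False
  have "ip (w f i - w g i) (w f j - w g j) = 0" if "f \<in> F" "g \<in> F" for f g
  proof -
    have "f = g" using that False by blast
    then show ?thesis by (simp add: ip_def)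
  qed
  then show ?thesis by (intro exI[of _ 0]) simp
next
  case True
  then obtain f0 g0 where 0: "f0 \<in> F" "g0 \<in> F" "f0 \<noteq> g0" by blast
  define n0 where "n0 = nsq (f0 - g0)"
  have n0: "n0 > 0" using 0 nsq_pos_iff unfolding n0_def by (metis eq_iff_diff_eq_0)
  define u where "u f g k = w f k - w g k" for f g k
  obtain s :: real where s: "\<And>f g. f \<in> F \<Longrightarrow> g \<in> F \<Longrightarrow>
      real_of_int (nsq (wval K I (u f g))) = s * real_of_int (nsq (f - g))"
    using sim unfolding similar_def wval_diff u_def by blast
  have key: "n0 * ip (u f g i) (u f g j) - nsq (f - g) * ip (u f0 g0 i) (u f0 g0 j) = 0"
    if fg: "f \<in> F" "g \<in> F" for f g
  proof (rule symmetric_quadratic_eq_0[where q="\<lambda>i j. n0 * ip (u f g i) (u f g j) - nsq (f - g) * ip (u f0 g0 i) (u f0 g0 j)"])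
    have "real_of_int (n0 * nsq (wval K I (u f g))) = real_of_int (nsq (f - g) * nsq (wval K I (u f0 g0)))"
      using s[OF fg] s[OF 0(1,2)] unfolding n0_def by simp
    then have "n0 * nsq (wval K I (u f g)) - nsq (f - g) * nsq (wval K I (u f0 g0)) = 0"
      using of_int_eq_iff by (metis diff_self)
    then show "(\<Sum>(i, j)\<in>I \<times> I. (n0 * ip (u f g i) (u f g j) - nsq (f - g) * ip (u f0 g0 i) (u f0 g0 j))
        * K ^ (3 ^ i + 3 ^ j)) = 0"
      unfolding ip_wval sum_distrib_left sum_subtractf[symmetric]
      by (simp add: case_prod_beta algebra_simps)
    fix i j assume ij: "i \<in> I" "j \<in> I"
    have ub: "\<bar>u f g k $ c\<bar> \<le> 2 * b" if "f \<in> F" "g \<in> F" "k \<in> I" for f g k c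
      using bd[OF that(1,3), of c] bd[OF that(2,3), of c] unfolding u_def by simp
    have prod: "\<bar>n * ip (u f g i) (u f g j)\<bar> \<le> m * (int CARD('d) * (2 * b)\<^sup>2)"
      if "f \<in> F" "g \<in> F" "0 \<le> n" "n \<le> m" for f g n
    proof -
      have "\<bar>ip (u f g i) (u f g j)\<bar> \<le> int CARD('d) * (2 * b)\<^sup>2"
        by (rule abs_ip_le) (use ub that ij in blast)+
      then have "n * \<bar>ip (u f g i) (u f g j)\<bar> \<le> m * (int CARD('d) * (2 * b)\<^sup>2)"
        using that by (intro mult_mono) simp_all
      then show ?thesis using that(3) by (simp only: abs_mult abs_of_nonneg)
    qed
    have "\<bar>n0 * ip (u f g i) (u f g j)\<bar> \<le> m * (int CARD('d) * (2 * b)\<^sup>2)"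
      using prod[OF fg, of n0] n0 m[OF 0(1,2)] unfolding n0_def by simp
    moreover have "\<bar>nsq (f - g) * ip (u f0 g0 i) (u f0 g0 j)\<bar> \<le> m * (int CARD('d) * (2 * b)\<^sup>2)"
      using prod[OF 0(1,2), of "nsq (f - g)"] m[OF fg] nsq_nonneg[of "f - g"] by simp
    ultimately show "\<bar>n0 * ip (u f g i) (u f g j) - nsq (f - g) * ip (u f0 g0 i) (u f0 g0 j)\<bar>
        \<le> 2 * m * (int CARD('d) * (2 * b)\<^sup>2)"
      by linarith
  next
    show "n0 * ip (u f g i) (u f g j) - nsq (f - g) * ip (u f0 g0 i) (u f0 g0 j) =
      n0 * ip (u f g j) (u f g i) - nsq (f - g) * ip (u f0 g0 j) (u f0 g0 i)" for i j
      by (simp add: ip_commute)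
  qed (use I K ij in auto)
  have "real_of_int (ip (u f g i) (u f g j)) = real_of_int (ip (u f0 g0 i) (u f0 g0 j)) / n0 * real_of_int (nsq (f - g))"
    if fg: "f \<in> F" "g \<in> F" for f g
  proof -
    have "real_of_int (n0 * ip (u f g i) (u f g j)) = real_of_int (nsq (f - g) * ip (u f0 g0 i) (u f0 g0 j))"
      using key[OF fg] by linarith
    then show ?thesis using n0 by (simp add: field_simps)
  qed
  then show ?thesis unfolding u_def by blast
qed

text \<open>By the equality case of Cauchy-Schwarz, agreement of two blocks at two points forces
  the displacement vectors of both to coincide.\<close>

lemma similar_rigid:
  fixes F :: "(int ^ 'd) set"
  assumes z: "similar F z" and z': "similar F z'"
    and c: "\<And>f g. f \<in> F \<Longrightarrow> g \<in> F \<Longrightarrow>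
      real_of_int (ip (z f - z g) (z' f - z' g)) = c * real_of_int (nsq (f - g))"
    and gh: "g \<in> F" "h \<in> F" "g \<noteq> h" "z g = z' g" "z h = z' h" and f: "f \<in> F"
  shows "z f = z' f"
proof -
  obtain s where s: "\<And>f g. f \<in> F \<Longrightarrow> g \<in> F \<Longrightarrow> real_of_int (nsq (z f - z g)) = s * real_of_int (nsq (f - g))"
    using z unfolding similar_def by blast
  obtain s' where s': "\<And>f g. f \<in> F \<Longrightarrow> g \<in> F \<Longrightarrow> real_of_int (nsq (z' f - z' g)) = s' * real_of_int (nsq (f - g))"
    using z' unfolding similar_def by blast
  have "real_of_int (nsq (g - h)) \<noteq> 0" using gh nsq_eq_0_iff[of "g - h"] by simp
  then have "s = c" "s' = c" using s[OF gh(1,2)] s'[OF gh(1,2)] c[OF gh(1,2)] gh(4,5) by auto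
  let ?u = "z f - z g" and ?v = "z' f - z' g"
  have "nsq (?u - ?v) = nsq ?u - 2 * ip ?u ?v + nsq ?v"
    using ip_commute[of ?u ?v] by (simp only: ip_diff_left[of ?u ?v] ip_diff_right[of _ ?u ?v])
  then have "real_of_int (nsq (?u - ?v)) = 0"
    using s[OF f gh(1)] s'[OF f gh(1)] c[OF f gh(1)] \<open>s = c\<close> \<open>s' = c\<close> by simp
  then have "?u - ?v = 0" by (simp only: of_int_eq_0_iff nsq_eq_0_iff)
  then show ?thesis using gh(4) by simp
qed

section \<open>The partite construction\<close>

definition compatible :: "(int ^ 'd) set \<Rightarrow> 'v set set \<Rightarrow> (int ^ 'd) set \<Rightarrow> (int ^ 'd \<Rightarrow> 'v) \<Rightarrow> bool" where
  "compatible F H P \<pi> \<longleftrightarrow> (\<forall>z. similar F z \<longrightarrow> z ` F \<subseteq> P \<longrightarrow> \<pi> ` z ` F \<in> H)"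

text \<open>The clause for \<open>k = 3\<close> excludes three edges on four vertices. Amalgamation
  would produce this configuration when three coordinates meet a class at the three different points
  of \<open>F\<close>.\<close>

definition admissible :: "nat \<Rightarrow> 'v set set \<Rightarrow> bool" where
  "admissible k H \<longleftrightarrow> 3 \<le> k \<and> (\<forall>e\<in>H. card e = k) \<and>
    (k = 3 \<longrightarrow> (\<forall>v a b c. \<not> ({v, a, b} \<in> H \<and> {v, a, c} \<in> H \<and> {v, b, c} \<in> H)))"

lemma similar_cong:
  assumes "\<And>f. f \<in> F \<Longrightarrow> z f = z' f"
  shows "similar F z \<longleftrightarrow> similar F z'"
  unfolding similar_def using assms by simp

lemma similar_constant_or_similar:
  assumes "\<And>f g. f \<in> F \<Longrightarrow> g \<in> F \<Longrightarrow> real_of_int (nsq (z f - z g)) = c * real_of_int (nsq (f - g))"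
  shows "(\<forall>f\<in>F. \<forall>g\<in>F. z f = z g) \<or> similar F z"
proof (cases "c > 0")
  case True
  then show ?thesis using assms unfolding similar_def by blast
next
  case False
  have "z f = z g" if "f \<in> F" "g \<in> F" for f g
  proof -
    have "c * real_of_int (nsq (f - g)) \<le> 0"
      using False nsq_nonneg[of "f - g"] by (simp add: mult_nonpos_nonneg)
    then have "nsq (z f - z g) = 0"
      using assms[OF that] nsq_nonneg[of "z f - z g"] by linarith
    then show ?thesis using nsq_eq_0_iff[of "z f - z g"] by simp
  qed
  then show ?thesis by blast
qed

lemma wval_subst_line:
  assumes "finite I"
  shows "wval K I (subst_line l x) =
    (\<Sum>i\<in>{i\<in>I. l i \<noteq> None}. K ^ 3 ^ i *s the (l i)) + (\<Sum>i\<in>{i\<in>I. l i = None}. K ^ 3 ^ i) *s x"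
proof -
  have "wval K I (subst_line l x) =
      (\<Sum>i\<in>{i\<in>I. l i \<noteq> None} \<union> {i\<in>I. l i = None}. K ^ 3 ^ i *s subst_line l x i)"
    unfolding wval_def by (rule sum.cong) auto
  also have "\<dots> = (\<Sum>i\<in>{i\<in>I. l i \<noteq> None}. K ^ 3 ^ i *s subst_line l x i)
      + (\<Sum>i\<in>{i\<in>I. l i = None}. K ^ 3 ^ i *s subst_line l x i)"
    using assms by (intro sum.union_disjoint) auto
  also have "(\<Sum>i\<in>{i\<in>I. l i \<noteq> None}. K ^ 3 ^ i *s subst_line l x i) = (\<Sum>i\<in>{i\<in>I. l i \<noteq> None}. K ^ 3 ^ i *s the (l i))"
    by (rule sum.cong) (auto simp: subst_line_def)
  also have "(\<Sum>i\<in>{i\<in>I. l i = None}. K ^ 3 ^ i *s subst_line l x i) = (\<Sum>i\<in>{i\<in>I. l i = None}. K ^ 3 ^ i *s x)"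
    by (rule sum.cong) (auto simp: subst_line_def)
  also have "\<dots> = (\<Sum>i\<in>{i\<in>I. l i = None}. K ^ 3 ^ i) *s x"
    by (simp add: vec_eq_iff sum_distrib_right)
  finally show ?thesis .
qed

text \<open>If the copies in two coordinates meet the class \<open>A\<close> at different points of \<open>F\<close>, then they agree at all
  other points of \<open>F\<close>. By rigidity this is impossible if \<open>F\<close> has more than three points; otherwise it leads
  to a conflict of lines or to three edges on four vertices.\<close>

lemma amalgam_compatible:
  fixes F :: "(int ^ 'd) set" and \<pi> :: "int ^ 'd \<Rightarrow> 'v"
  defines "w \<equiv> \<lambda>l x f. subst_line (l f) (x f :: int ^ 'd)"
  assumes F: "finite F" and adm: "admissible (card F) H" and resp: "compatible F H P \<pi>"
    and A: "A = {x\<in>P. \<pi> x = v}"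
    and L: "\<And>f. f \<in> F \<Longrightarrow> line_over I A (l f)" "\<And>f. f \<in> F \<Longrightarrow> x f \<in> P"
    and noconf: "\<And>f g h. f \<in> F \<Longrightarrow> g \<in> F \<Longrightarrow> h \<in> F \<Longrightarrow> \<not> conflict I (l f) (l g) (l h)"
    and cross: "\<And>i j. i \<in> I \<Longrightarrow> j \<in> I \<Longrightarrow> \<exists>c::real. \<forall>f\<in>F. \<forall>g\<in>F.
      real_of_int (ip (w l x f i - w l x g i) (w l x f j - w l x g j)) = c * real_of_int (nsq (f - g))"
    and nonconst: "\<exists>i\<in>I. \<exists>f\<in>F. \<exists>g\<in>F. w l x f i \<noteq> w l x g i"
  shows "(\<lambda>f. \<pi> (x f)) ` F \<in> H"
proof -
  let ?w = "w l x"
  have k: "card F \<ge> 3" using adm unfolding admissible_def by blast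
  have Some_A: "?w f i \<in> A" if "f \<in> F" "i \<in> I" "l f i \<noteq> None" for f i
    using L(1)[OF that(1)] that unfolding line_over_def w_def subst_line_def by auto
  have None_x: "?w f i = x f" if "l f i = None" for f i
    using that unfolding w_def subst_line_def by simp
  have notA: "l f i = None" "x f = ?w f i" if "f \<in> F" "i \<in> I" "?w f i \<notin> A" for f i
  proof -
    show "l f i = None" using Some_A[OF that(1,2)] that(3) by blast
    then show "x f = ?w f i" using None_x by simp
  qed
  have wP: "?w f i \<in> P" if "f \<in> F" "i \<in> I" for f i
    using Some_A[OF that] None_x[of f i] L(2)[OF that(1)] A by (cases "l f i = None") auto
  \<comment> \<open>The coordinates that show a genuine similar copy; by \<open>dich\<close> every
    other coordinate shows a single point.\<close>
  define S where "S = {i\<in>I. similar F (\<lambda>f. ?w f i)}"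
  have dich: "i \<in> S \<or> (\<forall>f\<in>F. \<forall>g\<in>F. ?w f i = ?w g i)" if iI: "i \<in> I" for i
  proof -
    obtain c :: real where "\<forall>f\<in>F. \<forall>g\<in>F.
        real_of_int (ip (?w f i - ?w g i) (?w f i - ?w g i)) = c * real_of_int (nsq (f - g))"
      using cross[OF iI iI] by blast
    then show ?thesis
      using similar_constant_or_similar[of F "\<lambda>f. ?w f i" c] iI unfolding S_def by blast
  qed
  have S_ne: "S \<noteq> {}" using nonconst dich by blast
  have S_I: "i \<in> I" if "i \<in> S" for i using that unfolding S_def by blast
  have S_inj: "inj_on (\<lambda>f. ?w f i) F" if "i \<in> S" for i
    using that similar_inj unfolding S_def by blast
  have S_H: "(\<lambda>f. \<pi> (?w f i)) ` F \<in> H" if "i \<in> S" for i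
  proof -
    have "(\<lambda>f. ?w f i) ` F \<subseteq> P" using wP S_I[OF that] by blast
    then have "\<pi> ` (\<lambda>f. ?w f i) ` F \<in> H"
      using resp that unfolding compatible_def S_def by blast
    then show ?thesis by (simp add: image_image)
  qed
  have S_pi_inj: "inj_on (\<lambda>f. \<pi> (?w f i)) F" if "i \<in> S" for i
    using S_H[OF that] adm F unfolding admissible_def by (intro eq_card_imp_inj_on) auto
  \<comment> \<open>The projection is injective on a copy, because edges have \<open>card F\<close>
    elements, but constant on \<open>A\<close>.\<close>
  have unique: "f = g" if "i \<in> S" "f \<in> F" "g \<in> F" "?w f i \<in> A" "?w g i \<in> A" for i f g
    using inj_onD[OF S_pi_inj[OF that(1)]] that(2-5) A by simp
  \<comment> \<open>A constant value outside \<open>A\<close> would force a wildcard at every point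
    of \<open>F\<close> and make \<open>x\<close> constant. In a similar coordinate, however, at
    least two points lie outside \<open>A\<close>, and there \<open>x\<close> takes different
    values.\<close>
  have const_A: "?w f i \<in> A" if i: "i \<in> I" "i \<notin> S" and f: "f \<in> F" for f i
  proof (rule ccontr)
    assume nA: "?w f i \<notin> A"
    have const: "?w g i = ?w f i" if "g \<in> F" for g using dich[OF i(1)] i(2) f that by blast
    have xg: "x g = ?w f i" if "g \<in> F" for g
      using notA(2)[OF that i(1)] const[OF that] nA by simp
    obtain j where j: "j \<in> S" using S_ne by blast
    have fin: "finite {g\<in>F. ?w g j \<in> A}" using F by simp
    have "card {g\<in>F. ?w g j \<in> A} \<le> 1"
      using unique[OF j] by (auto simp: card_le_Suc0_iff_eq[OF fin])
    then have "card (F - {g\<in>F. ?w g j \<in> A}) \<ge> 2"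
      using k F by (subst card_Diff_subset) auto
    then have "\<not> (\<forall>g\<in>F - {g\<in>F. ?w g j \<in> A}. \<forall>h\<in>F - {g\<in>F. ?w g j \<in> A}. g = h)"
      using F card_le_Suc0_iff_eq[of "F - {g\<in>F. ?w g j \<in> A}"] by auto
    then obtain g h where gh: "g \<in> F" "h \<in> F" "g \<noteq> h" "?w g j \<notin> A" "?w h j \<notin> A" by blast
    have "?w g j = ?w h j"
      using notA(2)[OF gh(1) S_I[OF j] gh(4)] notA(2)[OF gh(2) S_I[OF j] gh(5)] xg gh(1,2) by simp
    then show False using inj_onD[OF S_inj[OF j]] gh by blast
  qed
  show ?thesis
  proof (cases "\<exists>i\<in>S. \<forall>f\<in>F. ?w f i \<notin> A")
    case True
    then obtain i where i: "i \<in> S" "\<And>f. f \<in> F \<Longrightarrow> ?w f i \<notin> A" by blast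
    have "(\<lambda>f. \<pi> (x f)) ` F = (\<lambda>f. \<pi> (?w f i)) ` F"
      using notA(2)[OF _ S_I[OF i(1)] i(2)] by (intro image_cong) simp_all
    then show ?thesis using S_H[OF i(1)] by simp
  next
    case False
    \<comment> \<open>\<open>m i\<close> is the only point of \<open>F\<close> at which coordinate
      \<open>i\<close> meets \<open>A\<close>; at all other points the coordinate shows
      \<open>x\<close>.\<close>
    then obtain m where m: "\<And>i. i \<in> S \<Longrightarrow> m i \<in> F" "\<And>i. i \<in> S \<Longrightarrow> ?w (m i) i \<in> A" by metis
    have m': "?w f i \<notin> A" if "i \<in> S" "f \<in> F" "f \<noteq> m i" for f i
      using unique[OF that(1,2) m(1)[OF that(1)] _ m(2)[OF that(1)]] that(3) by blast
    have x_eq: "x f = ?w f i" if "i \<in> S" "f \<in> F" "f \<noteq> m i" for f i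
      using notA(2)[OF that(2) S_I[OF that(1)] m'[OF that]] .
    obtain i where i: "i \<in> S" using S_ne by blast
    show ?thesis
    proof (cases "\<forall>j\<in>S. m j = m i")
      case True
      \<comment> \<open>Every coordinate at the point \<open>m i\<close> now lies in
        \<open>A\<close>, including an active one, which shows \<open>x (m i)\<close>. So replacing
        the letter by \<open>x (m i)\<close> does not change the projection.\<close>
      have "?w (m i) j \<in> A" if "j \<in> I" for j
        using const_A[OF that _ m(1)[OF i]] m(2) True by (cases "j \<in> S") auto
      moreover obtain j where "j \<in> I" "l (m i) j = None"
        using L(1)[OF m(1)[OF i]] unfolding line_over_def by blast
      ultimately have "x (m i) \<in> A" using None_x[of "m i" j] by metis
      then have "\<pi> (x (m i)) = \<pi> (?w (m i) i)" using m(2)[OF i] A by simp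
      then have "(\<lambda>f. \<pi> (x f)) ` F = (\<lambda>f. \<pi> (?w f i)) ` F"
        using x_eq[OF i] by (intro image_cong) metis+
      then show ?thesis using S_H[OF i] by simp
    next
      case False
      then obtain j where j: "j \<in> S" "m j \<noteq> m i" by blast
      let ?f = "m i" and ?g = "m j"
      have fF: "?f \<in> F" and gF: "?g \<in> F" using m(1) i j by auto
      have diff: "\<not> (\<forall>f\<in>F. ?w f i = ?w f j)"
        using m'[OF i gF j(2)] m(2)[OF j(1)] gF by metis
      have "card (F - {?f, ?g}) = card F - 2"
        using F fF gF j(2) by (simp add: card_Diff_subset)
      have k3: "card F = 3"
      proof (rule ccontr)
        assume "card F \<noteq> 3"
        then have "card (F - {?f, ?g}) \<ge> 2" using k \<open>card (F - {?f, ?g}) = card F - 2\<close> by simp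
        then have "\<not> (\<forall>a\<in>F - {?f, ?g}. \<forall>b\<in>F - {?f, ?g}. a = b)"
          using F card_le_Suc0_iff_eq[of "F - {?f, ?g}"] by auto
        then obtain a b where ab: "a \<in> F" "b \<in> F" "a \<noteq> b" "a \<noteq> ?f" "a \<noteq> ?g" "b \<noteq> ?f" "b \<noteq> ?g"
          by blast
        obtain c :: real where c: "\<And>f g. f \<in> F \<Longrightarrow> g \<in> F \<Longrightarrow>
            real_of_int (ip (?w f i - ?w g i) (?w f j - ?w g j)) = c * real_of_int (nsq (f - g))"
          using cross[OF S_I[OF i] S_I[OF j(1)]] by blast
        have "?w a i = ?w a j" "?w b i = ?w b j"
          using x_eq[OF i ab(1,4)] x_eq[OF j(1) ab(1,5)] x_eq[OF i ab(2,6)] x_eq[OF j(1) ab(2,7)] by auto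
        then have "?w f i = ?w f j" if "f \<in> F" for f
          using similar_rigid[of F "\<lambda>f. ?w f i" "\<lambda>f. ?w f j" c a b f] c ab(1-3) i j(1) that
          unfolding S_def by blast
        then show False using diff by blast
      qed
      then have "card (F - {?f, ?g}) = 1" using \<open>card (F - {?f, ?g}) = card F - 2\<close> by simp
      then obtain h where h: "F - {?f, ?g} = {h}" using card_1_singletonE by blast
      then have F3: "F = {?f, ?g, h}" and hF: "h \<in> F" and hne: "h \<noteq> ?f" "h \<noteq> ?g" using fF gF by auto
      have im: "(\<lambda>f. \<pi> (?w f n)) ` F = {\<pi> (?w ?f n), \<pi> (?w ?g n), \<pi> (?w h n)}" for n
        by (subst F3) simp
      show ?thesis
      \<comment> \<open>If all three points of \<open>F\<close> occur as meeting points, three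
        copies project to three edges on \<open>v\<close> and the projections of the values of
        \<open>x\<close>, which \<open>admissible\<close> excludes.\<close>
      proof (cases "\<exists>n\<in>S. m n = h")
        case True
        then obtain n where n: "n \<in> S" "m n = h" by blast
        have v: "\<pi> (?w ?f i) = v" "\<pi> (?w ?g j) = v" "\<pi> (?w h n) = v"
          using m(2)[OF i] m(2)[OF j(1)] m(2)[OF n(1)] n(2) A by auto
        have "{v, \<pi> (x ?g), \<pi> (x h)} \<in> H"
          using S_H[OF i] v x_eq[OF i gF j(2)] x_eq[OF i hF hne(1)] unfolding im by simp
        moreover have "{v, \<pi> (x ?f), \<pi> (x h)} \<in> H"
          using S_H[OF j(1)] v x_eq[OF j(1) fF j(2)[symmetric]] x_eq[OF j(1) hF hne(2)] unfolding im
          by (simp add: insert_commute)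
        moreover have "{v, \<pi> (x ?f), \<pi> (x ?g)} \<in> H"
          using S_H[OF n(1)] v x_eq[OF n(1) fF] x_eq[OF n(1) gF] n(2) hne unfolding im
          by (simp add: insert_commute)
        ultimately show ?thesis using adm k3 unfolding admissible_def by blast
      next
        case False
        have m_cases: "m n = ?f \<or> m n = ?g" if "n \<in> S" for n
          using that False m(1)[OF that] F3 by blast
        have xA: "x ?f \<notin> A" "x ?g \<notin> A" "x h \<notin> A"
          using x_eq[OF j(1) fF j(2)[symmetric]] m'[OF j(1) fF j(2)[symmetric]]
            x_eq[OF i gF j(2)] m'[OF i gF j(2)] x_eq[OF i hF hne(1)] m'[OF i hF hne(1)] by auto
        then have xA': "x f \<notin> A" if "f \<in> F" for f using that F3 by blast
        have None_iff: "l f n = None \<longleftrightarrow> ?w f n \<notin> A" if "f \<in> F" "n \<in> I" for f n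
          using notA(1)[OF that] None_x[of f n] xA'[OF that(1)] by auto
        have Some_w: "l f n = Some (?w f n)" if "f \<in> F" "n \<in> I" "?w f n \<in> A" for f n
          using None_iff[OF that(1,2)] that(3) unfolding w_def subst_line_def by auto
        \<comment> \<open>No value of \<open>x\<close> lies in \<open>A\<close>, so wildcards are
          exactly the coordinates outside \<open>A\<close>. The active set of \<open>l h\<close> is
          \<open>S\<close>, and \<open>m\<close> divides it between \<open>l ?f\<close> and
          \<open>l ?g\<close>.\<close>
        have "conflict I (l h) (l ?f) (l ?g)"
          unfolding conflict_def
        proof (intro conjI ballI)
          fix n assume n: "n \<in> I"
          show "l h n \<noteq> None \<and> l ?f n = l h n \<and> l ?g n = l h n \<or>
              l h n = None \<and> (l ?f n = None \<longleftrightarrow> l ?g n \<noteq> None)"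
          proof (cases "n \<in> S")
            case True
            then consider "m n = ?f" | "m n = ?g" using m_cases by blast
            then show ?thesis
              using m(2)[OF True] m'[OF True hF] m'[OF True fF] m'[OF True gF] hne j(2)
              by cases (simp_all add: None_iff[OF hF n] None_iff[OF fF n] None_iff[OF gF n])
          next
            case False
            then have "?w ?f n = ?w h n" "?w ?g n = ?w h n" using dich[OF n] fF gF hF by blast+
            then show ?thesis
              using Some_w[OF hF n const_A[OF n False hF]] Some_w[OF fF n const_A[OF n False fF]]
                Some_w[OF gF n const_A[OF n False gF]] by simp
          qed
        next
          show "\<exists>n\<in>I. l h n = None \<and> l ?f n \<noteq> None"
            using S_I[OF i] None_iff[OF hF S_I[OF i]] None_iff[OF fF S_I[OF i]] m(2)[OF i] m'[OF i hF hne(1)]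
            by blast
          show "\<exists>n\<in>I. l h n = None \<and> l ?g n \<noteq> None"
            using S_I[OF j(1)] None_iff[OF hF S_I[OF j(1)]] None_iff[OF gF S_I[OF j(1)]] m(2)[OF j(1)]
              m'[OF j(1) hF hne(2)] by blast
        qed
        then show ?thesis using noconf[OF hF fF gF] by blast
      qed
    qed
  qed
qed

section \<open>The Ramsey step for one vertex class and its iteration\<close>

definition part_ramsey ::
  "nat \<Rightarrow> 'v set \<Rightarrow> (int ^ 'd) set \<Rightarrow> (int ^ 'd \<Rightarrow> 'v) \<Rightarrow> (int ^ 'd) set \<Rightarrow> (int ^ 'd \<Rightarrow> 'v) \<Rightarrow> bool" where
  "part_ramsey r V P \<pi> Q \<rho> \<longleftrightarrow> (\<forall>col :: int ^ 'd \<Rightarrow> nat. (\<forall>x\<in>Q. col x < r) \<longrightarrow>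
    (\<exists>t lam. lam > 0 \<and> (\<forall>x\<in>P. t + lam *s x \<in> Q \<and> \<rho> (t + lam *s x) = \<pi> x) \<and>
      (\<forall>x\<in>P. \<forall>y\<in>P. \<pi> x = \<pi> y \<longrightarrow> \<pi> x \<in> V \<longrightarrow> col (t + lam *s x) = col (t + lam *s y))))"

lemma part_ramsey_refl:
  assumes "\<And>x. x \<in> P \<Longrightarrow> \<pi> x \<notin> V"
  shows "part_ramsey r V P \<pi> P \<pi>"
  unfolding part_ramsey_def using assms
  by (intro allI impI exI[of _ 0] exI[of _ 1]) simp

lemma finite_coords_bounded:
  assumes "finite (P :: (int ^ 'd) set)"
  obtains b where "b \<ge> 0" "\<And>x c. x \<in> P \<Longrightarrow> \<bar>x $ c\<bar> \<le> b"
proof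
  let ?B = "insert 0 ((\<lambda>(x, c). \<bar>x $ c\<bar>) ` (P \<times> UNIV))"
  have fin: "finite ?B" using assms by simp
  show "Max ?B \<ge> 0" using fin by (intro Max_ge) auto
  show "\<bar>x $ c\<bar> \<le> Max ?B" if "x \<in> P" for x c
    using fin that by (intro Max_ge) auto
qed

lemma finite_nsq_bounded:
  assumes "finite (F :: (int ^ 'd) set)"
  obtains m where "m \<ge> 1" "\<And>f g. f \<in> F \<Longrightarrow> g \<in> F \<Longrightarrow> nsq (f - g) \<le> m"
proof
  let ?B = "insert 1 ((\<lambda>(f, g). nsq (f - g)) ` (F \<times> F))"
  have fin: "finite ?B" using assms by simp
  show "Max ?B \<ge> 1" using fin by (intro Max_ge) auto
  show "nsq (f - g) \<le> Max ?B" if "f \<in> F" "g \<in> F" for f g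
    using fin that by (intro Max_ge) auto
qed

text \<open>Hales-Jewett is applied with the class of \<open>v\<close> as alphabet. Substituting all
  of \<open>P\<close> into a line gives a homothetic copy of \<open>P\<close> whose class over
  \<open>v\<close> consists of the points of that line.\<close>

lemma partite_step:
  fixes F P :: "(int ^ 'd) set" and \<pi> :: "int ^ 'd \<Rightarrow> 'v"
  assumes F: "finite F" and adm: "admissible (card F) H" and P: "finite P" and comp: "compatible F H P \<pi>"
    and r: "r \<ge> 1"
  shows "\<exists>Q \<rho>. finite Q \<and> compatible F H Q \<rho> \<and> part_ramsey r {v} P \<pi> Q \<rho>"
proof (cases "{x\<in>P. \<pi> x = v} = {}")
  case True
  then have "part_ramsey r {v} P \<pi> P \<pi>"
    by (intro part_ramsey_refl) auto
  then show ?thesis using P comp by blast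
next
  case False
  define A where "A = {x\<in>P. \<pi> x = v}"
  have finA: "finite A" using P unfolding A_def by simp
  obtain I L where sys: "sparse_HJ r A I L"
    using sparse_Hales_Jewett[OF finA] False unfolding A_def by blast
  have I: "finite I" "finite L" and lines: "\<And>l. l \<in> L \<Longrightarrow> line_over I A l"
    and noconf: "\<And>l1 l2 l3. l1 \<in> L \<Longrightarrow> l2 \<in> L \<Longrightarrow> l3 \<in> L \<Longrightarrow> \<not> conflict I l1 l2 l3"
    and mono: "\<And>col :: (nat \<Rightarrow> int ^ 'd) \<Rightarrow> nat. (\<forall>w. (\<forall>i\<in>I. w i \<in> A) \<longrightarrow> col w < r) \<Longrightarrow>
      \<exists>l\<in>L. \<forall>a\<in>A. \<forall>b\<in>A. col (subst_line l a) = col (subst_line l b)"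
    using sys unfolding sparse_HJ_def by blast+
  obtain b where b: "b \<ge> 0" "\<And>x c. x \<in> P \<Longrightarrow> \<bar>x $ c\<bar> \<le> b"
    using finite_coords_bounded[OF P] by blast
  obtain m where m: "m \<ge> 1" "\<And>f g. f \<in> F \<Longrightarrow> g \<in> F \<Longrightarrow> nsq (f - g) \<le> m"
    using finite_nsq_bounded[OF F] by blast
  \<comment> \<open>The first summand is the threshold in \<open>similar_wval\<close>;
    \<open>2 * b\<close> bounds the difference of two letters for \<open>wval_inj\<close>; the last
    summand makes both bounds strict.\<close>
  define K where "K = int (card I * card I) * (2 * m * (int CARD('d) * (2 * b)\<^sup>2)) + 2 * b + 1"
  have K: "int (card I * card I) * (2 * m * (int CARD('d) * (2 * b)\<^sup>2)) < K" "2 * b < K" "0 < K"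
    using b(1) m(1) unfolding K_def by (auto intro!: add_nonneg_pos)
  define val where "val l x = wval K I (subst_line l x)" for l :: "nat \<Rightarrow> (int ^ 'd) option" and x
  have AP: "A \<subseteq> P" unfolding A_def by blast
  have sub_P: "subst_line l x i \<in> P" if "l \<in> L" "x \<in> P" "i \<in> I" for l x i
    using lines[OF that(1)] that AP unfolding line_over_def subst_line_def by (auto split: option.splits)
  have word_eq: "subst_line l x i = subst_line l' x' i"
    if l: "l \<in> L" "l' \<in> L" "x \<in> P" "x' \<in> P" and i: "i \<in> I" and eq: "val l x = val l' x'" for l l' x x' i
  proof -
    have "wval K I (\<lambda>i. subst_line l x i - subst_line l' x' i) = 0"
      using eq unfolding val_def by (simp flip: wval_diff)
    moreover have "\<bar>(subst_line l x i - subst_line l' x' i) $ c\<bar> < K" if "i \<in> I" for i c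
      using b(2)[OF sub_P[OF l(1,3) that], of c] b(2)[OF sub_P[OF l(2,4) that], of c] K(2) by simp
    ultimately have "subst_line l x i - subst_line l' x' i = 0"
      using wval_inj[OF I(1) _ _ i, of "\<lambda>i. subst_line l x i - subst_line l' x' i" K] by blast
    then show ?thesis by simp
  qed
  have None_ex: "\<exists>i\<in>I. l i = None" if "l \<in> L" for l
    using lines[OF that] unfolding line_over_def by blast
  have pi_eq: "\<pi> x = \<pi> x'"
    if l: "l \<in> L" "l' \<in> L" "x \<in> P" "x' \<in> P" and eq: "val l x = val l' x'" for l l' x x'
  proof -
    \<comment> \<open>A wildcard of \<open>l\<close> shows \<open>x\<close>. Since \<open>x\<close>
      is not in the alphabet, \<open>l'\<close> has a wildcard there as well, and that shows
      \<open>x'\<close>.\<close>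
    have aux: "\<pi> x = \<pi> x'"
      if l: "l \<in> L" "l' \<in> L" "x \<in> P" "x' \<in> P" and eq: "val l x = val l' x'" and xA: "x \<notin> A" for l l' x x'
    proof -
      obtain i where i: "i \<in> I" "l i = None" using None_ex[OF l(1)] by blast
      have "subst_line l' x' i = x"
        using word_eq[OF l i(1) eq] i(2) by (simp add: subst_line_def)
      moreover have "l' i = None"
      proof (rule ccontr)
        assume "l' i \<noteq> None"
        then have "subst_line l' x' i \<in> A"
          using lines[OF l(2)] i(1) unfolding line_over_def subst_line_def by auto
        then show False using xA \<open>subst_line l' x' i = x\<close> by simp
      qed
      ultimately show ?thesis by (simp add: subst_line_def)
    qed
    show ?thesis
    proof (cases "x \<in> A \<and> x' \<in> A")
      case True
      then show ?thesis unfolding A_def by simp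
    next
      case False
      then show ?thesis using aux[OF l eq] aux[OF l(2,1,4,3) eq[symmetric]] by auto
    qed
  qed
  define Q where "Q = (\<lambda>(l, x). val l x) ` (L \<times> P)"
  \<comment> \<open>A point of \<open>Q\<close> may have several representations; by
    \<open>pi_eq\<close> they all give the same projection.\<close>
  define \<rho> where "\<rho> y = (SOME u. \<exists>l\<in>L. \<exists>x\<in>P. y = val l x \<and> u = \<pi> x)" for y
  have rho: "\<rho> (val l x) = \<pi> x" if "l \<in> L" "x \<in> P" for l x
    unfolding \<rho>_def
  proof (rule some_equality)
    show "\<exists>l'\<in>L. \<exists>x'\<in>P. val l x = val l' x' \<and> \<pi> x = \<pi> x'" using that by blast
    show "u = \<pi> x" if "\<exists>l'\<in>L. \<exists>x'\<in>P. val l x = val l' x' \<and> u = \<pi> x'" for u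
      using that pi_eq[OF \<open>l \<in> L\<close> _ \<open>x \<in> P\<close>] by metis
  qed
  have "compatible F H Q \<rho>"
    unfolding compatible_def
  proof (intro allI impI)
    fix y assume y: "similar F y" "y ` F \<subseteq> Q"
    have "\<exists>l x. l \<in> L \<and> x \<in> P \<and> y f = val l x" if "f \<in> F" for f
    proof -
      have "y f \<in> Q" using y(2) that by blast
      then show ?thesis unfolding Q_def by auto
    qed
    then obtain l x where lx: "\<And>f. f \<in> F \<Longrightarrow> l f \<in> L" "\<And>f. f \<in> F \<Longrightarrow> x f \<in> P"
      "\<And>f. f \<in> F \<Longrightarrow> y f = val (l f) (x f)" by metis
    define w where "w f = subst_line (l f) (x f)" for f
    have sim: "similar F (\<lambda>f. wval K I (w f))"
      using y(1) similar_cong[of F y "\<lambda>f. wval K I (w f)"] lx(3) unfolding w_def val_def by simp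
    have wb: "\<bar>w f i $ c\<bar> \<le> b" if "f \<in> F" "i \<in> I" for f i c
      using b(2) sub_P lx that unfolding w_def by blast
    have cross: "\<exists>c::real. \<forall>f\<in>F. \<forall>g\<in>F.
        real_of_int (ip (w f i - w g i) (w f j - w g j)) = c * real_of_int (nsq (f - g))"
      if "i \<in> I" "j \<in> I" for i j
      by (rule similar_wval[OF sim I(1) wb m(2) K(1) that])
    have nonconst: "\<exists>i\<in>I. \<exists>f\<in>F. \<exists>g\<in>F. w f i \<noteq> w g i"
    proof (rule ccontr)
      assume no: "\<not> ?thesis"
      have "\<not> (\<forall>f\<in>F. \<forall>g\<in>F. f = g)"
        using adm F card_le_Suc0_iff_eq[of F] unfolding admissible_def by auto
      then obtain f g where fg: "f \<in> F" "g \<in> F" "f \<noteq> g" by blast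
      have "w f i = w g i" if "i \<in> I" for i using no fg that by blast
      then have "wval K I (w f) = wval K I (w g)"
        unfolding wval_def by (intro sum.cong) simp_all
      then show False using similar_inj[OF sim] fg by (auto dest: inj_onD)
    qed
    have "(\<lambda>f. \<pi> (x f)) ` F \<in> H"
    proof (rule amalgam_compatible[OF F adm comp A_def, where I=I and l=l])
      show "line_over I A (l f)" "x f \<in> P" if "f \<in> F" for f
        using lines[OF lx(1)[OF that]] lx(2)[OF that] by simp_all
      show "\<not> conflict I (l f) (l g) (l h)" if "f \<in> F" "g \<in> F" "h \<in> F" for f g h
        by (rule noconf[OF lx(1)[OF that(1)] lx(1)[OF that(2)] lx(1)[OF that(3)]])
    qed (fact cross[unfolded w_def] nonconst[unfolded w_def])+
    moreover have "\<rho> ` y ` F = (\<lambda>f. \<pi> (x f)) ` F"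
      unfolding image_image using rho lx by (intro image_cong) simp_all
    ultimately show "\<rho> ` y ` F \<in> H" by simp
  qed
  moreover have "part_ramsey r {v} P \<pi> Q \<rho>"
    unfolding part_ramsey_def
  proof (intro allI impI)
    fix col :: "int ^ 'd \<Rightarrow> nat" assume col: "\<forall>x\<in>Q. col x < r"
    \<comment> \<open>A word over \<open>A\<close> need not lie on a line of \<open>L\<close>, so
      its value may fall outside \<open>Q\<close>; the default \<open>0\<close> is a legal colour
      because \<open>r \<ge> 1\<close>.\<close>
    define word_col where "word_col w = (if wval K I w \<in> Q then col (wval K I w) else 0)" for w
    have "\<forall>w. (\<forall>i\<in>I. w i \<in> A) \<longrightarrow> word_col w < r"
      using col r by (simp add: word_col_def)
    from mono[OF this] obtain l where l: "l \<in> L"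
      "\<And>a b. a \<in> A \<Longrightarrow> b \<in> A \<Longrightarrow> word_col (subst_line l a) = word_col (subst_line l b)" by blast
    define t where "t = (\<Sum>i\<in>{i\<in>I. l i \<noteq> None}. K ^ 3 ^ i *s the (l i))"
    define lam where "lam = (\<Sum>i\<in>{i\<in>I. l i = None}. K ^ 3 ^ i)"
    have val: "val l x = t + lam *s x" for x
      unfolding val_def t_def lam_def by (rule wval_subst_line[OF I(1)])
    have "lam > 0"
      unfolding lam_def using None_ex[OF l(1)] I(1) K(3) by (intro sum_pos) auto
    moreover have inQ: "val l x \<in> Q" if "x \<in> P" for x
      unfolding Q_def using l(1) that by auto
    moreover have "col (val l x) = col (val l y)" if "x \<in> P" "y \<in> P" "\<pi> x = \<pi> y" "\<pi> x \<in> {v}" for x y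
      using l(2)[of x y] that inQ unfolding A_def word_col_def val_def by auto
    ultimately show "\<exists>t lam. lam > 0 \<and> (\<forall>x\<in>P. t + lam *s x \<in> Q \<and> \<rho> (t + lam *s x) = \<pi> x) \<and>
      (\<forall>x\<in>P. \<forall>y\<in>P. \<pi> x = \<pi> y \<longrightarrow> \<pi> x \<in> {v} \<longrightarrow> col (t + lam *s x) = col (t + lam *s y))"
      using rho[OF l(1)] unfolding val by blast
  qed
  moreover have "finite Q" unfolding Q_def using I P by simp
  ultimately show ?thesis by blast
qed

text \<open>A colouring of \<open>R\<close> is pulled back along a copy of \<open>Q\<close> whose
  classes over \<open>W\<close> are already monochromatic. The copy of \<open>P\<close> found inside
  it inherits this.\<close>

lemma part_ramsey_trans:
  fixes P Q R :: "(int ^ 'd) set"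
  assumes 1: "part_ramsey r V P \<pi> Q \<rho>" and 2: "part_ramsey r W Q \<rho> R \<sigma>"
  shows "part_ramsey r (V \<union> W) P \<pi> R \<sigma>"
  unfolding part_ramsey_def
proof (intro allI impI)
  fix col :: "int ^ 'd \<Rightarrow> nat" assume col: "\<forall>x\<in>R. col x < r"
  obtain t lam where 2: "lam > 0" "\<And>x. x \<in> Q \<Longrightarrow> t + lam *s x \<in> R" "\<And>x. x \<in> Q \<Longrightarrow> \<sigma> (t + lam *s x) = \<rho> x"
    "\<And>x y. x \<in> Q \<Longrightarrow> y \<in> Q \<Longrightarrow> \<rho> x = \<rho> y \<Longrightarrow> \<rho> x \<in> W \<Longrightarrow> col (t + lam *s x) = col (t + lam *s y)"
    using 2 col unfolding part_ramsey_def by blast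
  have "\<forall>x\<in>Q. col (t + lam *s x) < r" using 2(2) col by blast
  then obtain t' lam' where 1: "lam' > 0" "\<And>x. x \<in> P \<Longrightarrow> t' + lam' *s x \<in> Q" "\<And>x. x \<in> P \<Longrightarrow> \<rho> (t' + lam' *s x) = \<pi> x"
    "\<And>x y. x \<in> P \<Longrightarrow> y \<in> P \<Longrightarrow> \<pi> x = \<pi> y \<Longrightarrow> \<pi> x \<in> V \<Longrightarrow>
      col (t + lam *s (t' + lam' *s x)) = col (t + lam *s (t' + lam' *s y))"
    using 1[unfolded part_ramsey_def, rule_format, of "\<lambda>x. col (t + lam *s x)"] by blast
  have comp: "t + lam *s (t' + lam' *s x) = (t + lam *s t') + (lam * lam') *s x" for x
    by (simp add: vec_eq_iff algebra_simps)
  show "\<exists>t lam. lam > 0 \<and> (\<forall>x\<in>P. t + lam *s x \<in> R \<and> \<sigma> (t + lam *s x) = \<pi> x) \<and>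
      (\<forall>x\<in>P. \<forall>y\<in>P. \<pi> x = \<pi> y \<longrightarrow> \<pi> x \<in> V \<union> W \<longrightarrow> col (t + lam *s x) = col (t + lam *s y))"
  proof (rule exI[of _ "t + lam *s t'"], rule exI[of _ "lam * lam'"], unfold comp[symmetric], intro conjI ballI impI)
    show "lam * lam' > 0" using 1(1) 2(1) by simp
    show "t + lam *s (t' + lam' *s x) \<in> R" "\<sigma> (t + lam *s (t' + lam' *s x)) = \<pi> x" if "x \<in> P" for x
      using 1(2,3)[OF that] 2(2,3)[of "t' + lam' *s x"] by simp_all
    show "col (t + lam *s (t' + lam' *s x)) = col (t + lam *s (t' + lam' *s y))"
      if "x \<in> P" "y \<in> P" "\<pi> x = \<pi> y" "\<pi> x \<in> V \<union> W" for x y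
    proof (cases "\<pi> x \<in> V")
      case True
      then show ?thesis by (rule 1(4)[OF that(1-3)])
    next
      case False
      then show ?thesis
        using 2(4)[OF 1(2)[OF that(1)] 1(2)[OF that(2)]] 1(3)[OF that(1)] 1(3)[OF that(2)] that(3,4) by simp
    qed
  qed
qed

lemma partite_construction:
  fixes F P :: "(int ^ 'd) set" and \<pi> :: "int ^ 'd \<Rightarrow> 'v"
  assumes F: "finite F" and adm: "admissible (card F) H" and P: "finite P" and comp: "compatible F H P \<pi>"
    and r: "r \<ge> 1"
    and V: "finite V"
  shows "\<exists>Q \<rho>. finite Q \<and> compatible F H Q \<rho> \<and> part_ramsey r V P \<pi> Q \<rho>"
  using V
proof (induction V rule: finite_induct)
  case empty
  have "part_ramsey r {} P \<pi> P \<pi>"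
    by (intro part_ramsey_refl) auto
  then show ?case using P comp by blast
next
  case (insert v V)
  then obtain Q \<rho> where Q: "finite Q" "compatible F H Q \<rho>" "part_ramsey r V P \<pi> Q \<rho>" by blast
  obtain R \<sigma> where R: "finite R" "compatible F H R \<sigma>" "part_ramsey r {v} Q \<rho> R \<sigma>"
    using partite_step[OF F adm Q(1,2) r] by blast
  have "part_ramsey r (insert v V) P \<pi> R \<sigma>"
    using part_ramsey_trans[OF Q(3) R(3)] by simp
  then show ?case using R by blast
qed

section \<open>Far apart translates\<close>

text \<open>Distinct lattice points have squared distance at least \<open>1\<close>, so two squared
  distances in \<open>F\<close> have ratio at most \<open>m\<close>, and similarity preserves
  ratios.\<close>

lemma nsq_le_of_similar:
  assumes "similar F z" "f \<in> F" "g \<in> F" "h \<in> F" "f \<noteq> h" "nsq (f - g) \<le> m"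
  shows "nsq (z f - z g) \<le> m * nsq (z f - z h)"
proof -
  obtain s :: real where s: "s > 0"
    "\<And>f g. f \<in> F \<Longrightarrow> g \<in> F \<Longrightarrow> real_of_int (nsq (z f - z g)) = s * real_of_int (nsq (f - g))"
    using assms(1) unfolding similar_def by blast
  have "nsq (f - h) \<ge> 1" using assms(5) nsq_pos_iff[of "f - h"] by simp
  moreover have "m \<ge> 0" using assms(6) nsq_nonneg[of "f - g"] by linarith
  ultimately have "nsq (f - g) \<le> m * nsq (f - h)"
    using assms(6) mult_left_mono[of 1 "nsq (f - h)" m] by linarith
  then have "s * real_of_int (nsq (f - g)) \<le> s * real_of_int (m * nsq (f - h))"
    using s(1) by (intro mult_left_mono) (simp_all only: of_int_le_iff less_imp_le)
  then have "real_of_int (nsq (z f - z g)) \<le> real_of_int (m * nsq (z f - z h))"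
    using s(2)[OF assms(2,3)] s(2)[OF assms(2,4)] by (simp add: algebra_simps)
  then show ?thesis by (simp only: of_int_le_iff)
qed

lemma nsq_ge_coord: "(x $ c)\<^sup>2 \<le> nsq x"
  unfolding ip_def power2_eq_square by (rule member_le_sum) auto

text \<open>Bounds the coordinates in the first \<open>i\<close> translated blocks when the
  untranslated block \<open>j\<close> has coordinates of size at most \<open>b j\<close>. The
  summand with factor \<open>D\<close> is the gap left before the next block.\<close>

fun far_bound :: "int \<Rightarrow> (nat \<Rightarrow> int) \<Rightarrow> nat \<Rightarrow> int" where
  "far_bound D b 0 = 0"
| "far_bound D b (Suc i) = far_bound D b i + 2 * b i + D * (2 * b i + far_bound D b i) + 1"

definition separating :: "(int ^ 'd) set \<Rightarrow> (nat \<Rightarrow> (int ^ 'd) set) \<Rightarrow> (nat \<Rightarrow> int ^ 'd) \<Rightarrow> bool" where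
  "separating F S T \<longleftrightarrow>
    (\<forall>i. \<forall>x\<in>S i. \<forall>c. (T i + x) $ c \<ge> 0) \<and>
    (\<forall>i j. \<forall>x\<in>S i. \<forall>y\<in>S j. T i + x = T j + y \<longrightarrow> i = j) \<and>
    (\<forall>z. similar F z \<longrightarrow> z ` F \<subseteq> (\<Union>i. (+) (T i) ` S i) \<longrightarrow> (\<exists>i. z ` F \<subseteq> (+) (T i) ` S i))"

text \<open>Let \<open>n\<close> be the last block met by a copy. If an earlier block is met too,
  some three points contain a distance across the gap before block \<open>n\<close> and, from a
  common point, a distance inside block \<open>n\<close> or among the earlier blocks. Their ratio
  violates \<open>nsq_le_of_similar\<close>.\<close>

lemma separating_translations:
  fixes F :: "(int ^ 'd) set" and S :: "nat \<Rightarrow> (int ^ 'd) set"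
  assumes F: "finite F" "card F \<ge> 3" and S: "\<And>i. finite (S i)"
  shows "\<exists>T. separating F S T"
proof -
  have "\<exists>b. b \<ge> 0 \<and> (\<forall>x\<in>S i. \<forall>c. \<bar>x $ c\<bar> \<le> b)" for i
    using finite_coords_bounded[OF S[of i]] by metis
  then obtain b where b: "\<And>i. b i \<ge> 0" "\<And>i x c. x \<in> S i \<Longrightarrow> \<bar>x $ c\<bar> \<le> b i" by metis
  obtain m where m: "m \<ge> 1" "\<And>f g. f \<in> F \<Longrightarrow> g \<in> F \<Longrightarrow> nsq (f - g) \<le> m"
    using finite_nsq_bounded[OF F(1)] by blast
  define D where "D = m * int CARD('d)"
  have D: "D \<ge> 1" unfolding D_def using m(1) mult_mono[of 1 m 1 "int CARD('d)"] by simp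
  define V where "V = far_bound D b"
  \<comment> \<open>Bounds coordinate differences both inside block \<open>i\<close> and among all
    earlier blocks, whose coordinates lie between \<open>0\<close> and \<open>V i\<close>.\<close>
  define e where "e i = 2 * b i + V i" for i
  define \<tau> where "\<tau> i = b i + V i + D * e i + 1" for i
  have V_Suc: "V (Suc i) = \<tau> i + b i" for i unfolding V_def \<tau>_def e_def by simp
  have V0: "V i \<ge> 0" for i
  proof (induction i)
    case (Suc i)
    then have "D * e i \<ge> 0" using D b(1)[of i] unfolding e_def by simp
    then show ?case using Suc b(1)[of i] unfolding V_Suc \<tau>_def by simp
  qed (simp add: V_def)
  have De: "D * e i \<ge> 0" for i using D b(1)[of i] V0[of i] unfolding e_def by simp
  have V_mono: "V i \<le> V j" if "i \<le> j" for i j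
    by (rule lift_Suc_mono_le[OF _ that]) (use V_Suc \<tau>_def De b(1) in \<open>simp add: add_increasing2\<close>)
  define T :: "nat \<Rightarrow> int ^ 'd" where "T i = (\<chi> c. \<tau> i)" for i
  let ?B = "\<lambda>i. (+) (T i) ` S i"
  have lower: "x $ c > V i + D * e i" and upper: "x $ c \<le> V (Suc i)" if xB: "x \<in> ?B i" for x i c
  proof -
    obtain y where y: "y \<in> S i" "x = T i + y" using xB by blast
    then show "x $ c > V i + D * e i" "x $ c \<le> V (Suc i)"
      using b(2)[OF y(1), of c] unfolding V_Suc by (simp_all add: T_def \<tau>_def)
  qed
  have upper': "x $ c \<le> V i" if "x \<in> ?B j" "j < i" for x i j c
    using upper[OF that(1), of c] V_mono[of "Suc j" i] that(2) by simp
  have nonneg: "x $ c \<ge> 0" if "x \<in> ?B i" for x i c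
    using lower[OF that, of c] V0[of i] De[of i] by linarith
  have disj: "i = j" if "x \<in> ?B i" "x \<in> ?B j" for x i j
  proof -
    have "\<not> j < i" if "x \<in> ?B i" "x \<in> ?B j" for i j
    proof
      assume "j < i"
      then show False
        using upper'[OF that(2), of i undefined] lower[OF that(1), of undefined] De[of i] by linarith
    qed
    then show ?thesis using that by (meson linorder_neqE_nat)
  qed
  have gap: "nsq (x - y) > D * (e i)\<^sup>2" if "x \<in> ?B i" "y \<in> ?B j" "j < i" for x y i j
  proof -
    have "(x - y) $ undefined > D * e i"
      using lower[OF that(1), of undefined] upper'[OF that(2,3), of undefined] by simp
    then have "(D * e i)\<^sup>2 < ((x - y) $ undefined)\<^sup>2"
      using De[of i] by (intro power_strict_mono) auto
    then have "(D * e i)\<^sup>2 < nsq (x - y)" using nsq_ge_coord[of "x - y" undefined] by linarith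
    moreover have "D * (e i)\<^sup>2 \<le> (D * e i)\<^sup>2"
      using mult_right_mono[OF self_le_power[OF D, of 2], of "(e i)\<^sup>2"] by (simp add: power_mult_distrib)
    ultimately show ?thesis by linarith
  qed
  have close: "m * nsq (x - y) \<le> D * (e i)\<^sup>2" if "\<And>c. \<bar>(x - y) $ c\<bar> \<le> e i" for x y :: "int ^ 'd" and i
    using mult_left_mono[of "nsq (x - y)" "int CARD('d) * (e i)\<^sup>2" m] abs_ip_le[OF that that] m(1)
    unfolding D_def by (simp add: mult.assoc)
  show ?thesis
    unfolding separating_def
  proof (rule exI[of _ T], intro conjI allI ballI impI)
    show "(T i + x) $ c \<ge> 0" if "x \<in> S i" for i x c
      using nonneg[of "T i + x" i c] that by blast
    show "i = j" if "x \<in> S i" "y \<in> S j" "T i + x = T j + y" for i j x y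
      using disj[of "T i + x" i j] that by (metis imageI)
    fix z assume z: "similar F z" "z ` F \<subseteq> (\<Union>i. ?B i)"
    then have "\<forall>f\<in>F. \<exists>i. z f \<in> ?B i" by blast
    then obtain idx where idx: "\<And>f. f \<in> F \<Longrightarrow> z f \<in> ?B (idx f)" by metis
    define n where "n = Max (idx ` F)"
    have Fne: "F \<noteq> {}" using F by auto
    have n: "n \<in> idx ` F" "\<And>f. f \<in> F \<Longrightarrow> idx f \<le> n"
      using F(1) Fne unfolding n_def by (auto intro: Max_in)
    then obtain f where f: "f \<in> F" "idx f = n" by blast
    show "\<exists>i. z ` F \<subseteq> ?B i"
    proof (cases "\<forall>g\<in>F. idx g = n")
      case True
      have "z ` F \<subseteq> ?B n"
      proof
        fix y assume "y \<in> z ` F"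
        then obtain g where "g \<in> F" "y = z g" by blast
        then show "y \<in> ?B n" using idx[of g] True by simp
      qed
      then show ?thesis by (rule exI)
    next
      case False
      then obtain g where g: "g \<in> F" "idx g < n" using n(2) by (metis le_neq_implies_less)
      have "card {f, g} < card F" using F(2) by (simp add: card_insert_if)
      then have "\<not> F \<subseteq> {f, g}" using card_mono[of "{f, g}" F] by force
      then obtain h where h: "h \<in> F" "h \<noteq> f" "h \<noteq> g" by blast
      have big: "nsq (z f - z g) > D * (e n)\<^sup>2" using gap[of "z f" n "z g" "idx g"] idx f g by metis
      have big': "nsq (z g - z f) > D * (e n)\<^sup>2"
        using big by (simp add: ip_diff_left ip_diff_right algebra_simps)
      show ?thesis
      proof (cases "idx h = n")
        case True
        have "\<bar>(z f - z h) $ c\<bar> \<le> e n" for c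
        proof -
          obtain y y' where "y \<in> S n" "z f = T n + y" "y' \<in> S n" "z h = T n + y'"
            using idx[OF f(1)] idx[OF h(1)] f True by auto
          then show ?thesis
            using b(2)[of y n c] b(2)[of y' n c] V0[of n] unfolding e_def by simp
        qed
        from close[OF this] show ?thesis
          using big nsq_le_of_similar[OF z(1) f(1) g(1) h(1) h(2)[symmetric] m(2)[OF f(1) g(1)]] by linarith
      next
        case False
        then have hn: "idx h < n" using n(2)[OF h(1)] by simp
        have "\<bar>(z g - z h) $ c\<bar> \<le> e n" for c
          using upper'[OF idx[OF g(1)] g(2), of c] upper'[OF idx[OF h(1)] hn, of c]
            nonneg[OF idx[OF g(1)], of c] nonneg[OF idx[OF h(1)], of c] b(1)[of n]
          unfolding e_def by simp
        from close[OF this] show ?thesis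
          using big' nsq_le_of_similar[OF z(1) g(1) f(1) h(1) h(3)[symmetric] m(2)[OF g(1) f(1)]] by linarith
      qed
    qed
  qed
qed

section \<open>Windows of increasing tuples\<close>

definition window :: "nat \<Rightarrow> 'a list \<Rightarrow> nat \<Rightarrow> 'a list" where
  "window t xs j = take t (drop j xs)"

definition increasing_lists :: "nat \<Rightarrow> nat \<Rightarrow> nat list set" where
  "increasing_lists M n = {xs. strict_sorted xs \<and> set xs \<subseteq> {..<M} \<and> length xs = n}"

definition window_edges :: "nat \<Rightarrow> nat \<Rightarrow> nat \<Rightarrow> nat list set set" where
  "window_edges k t M = (\<lambda>xs. window t xs ` {..<k}) ` increasing_lists M (t + k - 1)"

lemma finite_increasing_lists: "finite (increasing_lists M n)"
  by (rule finite_subset[OF _ finite_lists_length_eq[of "{..<M}" n]]) (auto simp: increasing_lists_def)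

lemma window_nth:
  assumes "j < k" "i < t" "length xs = t + k - 1"
  shows "window t xs j ! i = xs ! (j + i)"
  using assms by (simp add: window_def)

lemma window_increasing:
  assumes "xs \<in> increasing_lists M (t + k - 1)" "j < k"
  shows "window t xs j \<in> increasing_lists M t"
proof -
  have "set (window t xs j) \<subseteq> set xs"
    unfolding window_def by (meson order_trans set_drop_subset set_take_subset)
  then show ?thesis
    using assms by (auto simp: increasing_lists_def window_def sorted_wrt_take sorted_wrt_drop)
qed

lemma window_0_less:
  assumes xs: "xs \<in> increasing_lists M (t + k - 1)" and "i < j" "j < k" "0 < t"
  shows "window t xs i ! 0 < window t xs j ! 0"
proof -
  have "strict_sorted xs" and len: "length xs = t + k - 1"
    using xs by (simp_all add: increasing_lists_def)
  then have "xs ! i < xs ! j"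
    using assms by (intro sorted_wrt_nth_less[of "(<)" xs i j]) simp_all
  then show ?thesis
    using assms len window_nth[of i k 0 t xs] window_nth[of j k 0 t xs] by simp
qed

lemma card_window_edge:
  assumes "e \<in> window_edges k t M" "0 < t"
  shows "card e = k"
proof -
  obtain xs where xs: "xs \<in> increasing_lists M (t + k - 1)" "e = window t xs ` {..<k}"
    using assms unfolding window_edges_def by blast
  have "inj_on (window t xs) {..<k}"
    using window_0_less[OF xs(1)] assms(2) by (intro linorder_inj_onI) (auto, metis less_irrefl)
  then show ?thesis using xs by (simp add: card_image)
qed

text \<open>Two windows of an edge differ by a shift of one or two places, so the first entry of the
  later one is the second or third entry of the earlier one.\<close>

lemma window_pair:
  assumes e: "e \<in> window_edges 3 t M" and t: "3 \<le> t" and ab: "a \<in> e" "b \<in> e" "a \<noteq> b"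
  shows "a ! 0 \<noteq> b ! 0 \<and> (a ! 0 \<le> b ! 0 \<longrightarrow> b ! 0 \<in> {a ! 1, a ! 2})"
proof -
  obtain xs where xs: "xs \<in> increasing_lists M (t + 3 - 1)" "e = window t xs ` {..<3}"
    using e unfolding window_edges_def by blast
  have len: "length xs = t + 3 - 1" using xs by (simp add: increasing_lists_def)
  obtain i j where ij: "a = window t xs i" "b = window t xs j" "i < 3" "j < 3" using ab xs by auto
  have "i \<noteq> j" using ij ab by blast
  then consider "i < j" | "j < i" by linarith
  then show ?thesis
  proof cases
    case 1
    then have "j - i = 1 \<or> j - i = 2" using ij by linarith
    moreover have "b ! 0 = a ! (j - i)"
      using ij 1 t len window_nth[of j 3 0 t xs] window_nth[of i 3 "j - i" t xs] by simp
    moreover have "a ! 0 < b ! 0" using window_0_less[OF xs(1) 1] ij t by simp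
    ultimately show ?thesis by auto
  next
    case 2
    then show ?thesis using window_0_less[OF xs(1) 2] ij t by simp
  qed
qed

text \<open>Among four vertices any two of which share an edge, let \<open>p\<close> be the one with the smallest
  first entry; the other three first entries are then distinct members of \<open>{p ! 1, p ! 2}\<close>.\<close>

lemma window_edges_no_K4_minus:
  assumes t: "3 \<le> t"
    and e: "{v, a, b} \<in> window_edges 3 t M" "{v, a, c} \<in> window_edges 3 t M" "{v, b, c} \<in> window_edges 3 t M"
  shows False
proof -
  let ?S = "{v, a, b, c}"
  have card3: "card {v, a, b} = 3" "card {v, a, c} = 3" "card {v, b, c} = 3"
    using e card_window_edge t by (auto simp: numeral_3_eq_3)
  then have dist: "distinct [v, a, b, c]" by (auto simp: card_insert_if split: if_splits)
  have pair: "x ! 0 \<noteq> y ! 0 \<and> (x ! 0 \<le> y ! 0 \<longrightarrow> y ! 0 \<in> {x ! 1, x ! 2})"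
    if "x \<in> ?S" "y \<in> ?S" "x \<noteq> y" for x y
  proof -
    have "x \<in> {v, a, b} \<and> y \<in> {v, a, b} \<or> x \<in> {v, a, c} \<and> y \<in> {v, a, c} \<or> x \<in> {v, b, c} \<and> y \<in> {v, b, c}"
      using that by blast
    then show ?thesis
      using window_pair[OF e(1) t _ _ that(3)] window_pair[OF e(2) t _ _ that(3)]
        window_pair[OF e(3) t _ _ that(3)] by blast
  qed
  define p where "p = arg_min_on (\<lambda>x. x ! 0) ?S"
  have p: "p \<in> ?S" "\<And>y. y \<in> ?S \<Longrightarrow> p ! 0 \<le> y ! 0"
    unfolding p_def by (rule arg_min_if_finite, simp, simp) (rule arg_min_least, auto)
  have "(\<lambda>x. x ! 0) ` (?S - {p}) \<subseteq> {p ! 1, p ! 2}"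
    using pair[OF p(1)] p(2) by blast
  moreover have "inj_on (\<lambda>x. x ! 0) (?S - {p})"
    using pair by (intro inj_onI) blast
  ultimately have "card (?S - {p}) \<le> card {p ! 1, p ! 2}"
    by (meson card_inj_on_le finite.emptyI finite.insertI)
  moreover have "card (?S - {p}) = 3" using p(1) dist by auto
  moreover have "card {p ! 1, p ! 2} \<le> 2" by (simp add: card_insert_if)
  ultimately show False by linarith
qed

text \<open>Ramsey's theorem for \<open>t\<close>-element sets, each coloured through its increasing
  listing. All windows of a homogeneous set with \<open>t + k - 1\<close> elements then have one
  colour.\<close>

lemma window_ramsey:
  "\<exists>M. \<forall>col. (\<forall>ws\<in>increasing_lists M t. col ws < r) \<longrightarrow>
    (\<exists>xs\<in>increasing_lists M (t + k - 1). \<exists>c. \<forall>j<k. col (window t xs j) = (c::nat))"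
proof -
  obtain M :: nat where M: "partn_lst {..<M} (replicate r (t + k - 1)) t"
    using ramsey_full[of "replicate r (t + k - 1)" t] by blast
  show ?thesis
  proof (intro exI[of _ M] allI impI)
    fix col :: "nat list \<Rightarrow> nat" assume col: "\<forall>ws\<in>increasing_lists M t. col ws < r"
    let ?f = "\<lambda>S. col (sorted_list_of_set S)"
    have "?f \<in> nsets {..<M} t \<rightarrow> {..<r}"
      using col by (auto simp: nsets_def increasing_lists_def)
    then obtain i S where S: "i < r" "S \<in> nsets {..<M} (t + k - 1)" "?f ` nsets S t \<subseteq> {i}"
      using partn_lstE[OF M, of ?f r] by (auto simp: nth_replicate)
    let ?xs = "sorted_list_of_set S"
    have xs: "?xs \<in> increasing_lists M (t + k - 1)"
      using S(2) by (auto simp: nsets_def increasing_lists_def)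
    have "col (window t ?xs j) = i" if "j < k" for j
    proof -
      have w: "window t ?xs j \<in> increasing_lists M t" by (rule window_increasing[OF xs that])
      have "set (window t ?xs j) \<subseteq> S"
        unfolding window_def using S(2)
        by (metis (no_types, lifting) finite_subset finite_lessThan mem_Collect_eq nsets_def order_trans
            set_drop_subset set_sorted_list_of_set set_take_subset)
      moreover have "card (set (window t ?xs j)) = t"
        using w strict_sorted_iff distinct_card by (force simp: increasing_lists_def)
      ultimately have "set (window t ?xs j) \<in> nsets S t" by (simp add: nsets_def)
      moreover have "sorted_list_of_set (set (window t ?xs j)) = window t ?xs j"
        using w by (intro sorted_list_of_set.idem_if_sorted_distinct)
          (auto simp: increasing_lists_def strict_sorted_iff)
      ultimately show ?thesis using S(3) by force
    qed
    then show "\<exists>xs\<in>increasing_lists M (t + k - 1). \<exists>c. \<forall>j<k. col (window t xs j) = c"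
      using xs by blast
  qed
qed

section \<open>The position of the maximum under a random permutation\<close>

definition max_at :: "nat \<Rightarrow> (nat \<Rightarrow> nat) \<Rightarrow> nat list \<Rightarrow> nat \<Rightarrow> bool" where
  "max_at t p ws i \<longleftrightarrow> (\<forall>j<t. p (ws ! j) \<le> p (ws ! i))"

lemma max_at_unique:
  assumes ws: "ws \<in> increasing_lists M t" and p: "p permutes {..<M}"
    and "i < t" "j < t" "max_at t p ws i" "max_at t p ws j"
  shows "i = j"
proof -
  have "p (ws ! i) = p (ws ! j)" using assms unfolding max_at_def by (meson le_antisym)
  then have "ws ! i = ws ! j" using permutes_inj[OF p] by (auto dest: injD)
  then show ?thesis
    using assms(1,3,4) nth_eq_iff_index_eq[of ws] by (auto simp: increasing_lists_def strict_sorted_iff)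
qed

text \<open>Composition with a transposition maps the event for one position injectively into that
  for any other, so all are equally large. Together they partition the permutations.\<close>

lemma card_max_at:
  assumes ws: "ws \<in> increasing_lists M t" and i: "i < t"
  shows "t * card {p. p permutes {..<M} \<and> max_at t p ws i} = card {p. p permutes {..<M}}"
proof -
  let ?A = "\<lambda>i. {p. p permutes {..<M} \<and> max_at t p ws i}"
  have fin: "finite {p. p permutes {..<M}}" by (simp add: finite_permutations)
  have len: "length ws = t" and dist: "distinct ws" and sub: "set ws \<subseteq> {..<M}"
    using ws by (auto simp: increasing_lists_def strict_sorted_iff)
  have le: "card (?A i) \<le> card (?A j)" if ij: "i < t" "j < t" for i j
  proof -
    let ?s = "Transposition.transpose (ws ! i) (ws ! j)"
    have sp: "?s permutes {..<M}"
      using ij len subsetD[OF sub nth_mem[of i ws]] subsetD[OF sub nth_mem[of j ws]]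
      by (intro permutes_swap_id) simp_all
    have "(\<lambda>p. p \<circ> ?s) ` ?A i \<subseteq> ?A j"
    proof
      fix q assume "q \<in> (\<lambda>p. p \<circ> ?s) ` ?A i"
      then obtain p where p: "p permutes {..<M}" "max_at t p ws i" "q = p \<circ> ?s" by blast
      have "q (ws ! l) \<le> q (ws ! j)" if "l < t" for l
      proof -
        have "?s (ws ! l) \<in> {ws ! i, ws ! j, ws ! l}" by (auto simp: Transposition.transpose_def)
        then have "p (?s (ws ! l)) \<le> p (ws ! i)" using p(2) ij that unfolding max_at_def by auto
        then show ?thesis using p(3) by simp
      qed
      then show "q \<in> ?A j" using permutes_compose[OF sp p(1)] p(3) unfolding max_at_def by simp
    qed
    moreover have "inj_on (\<lambda>p. p \<circ> ?s) (?A i)"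
      by (rule inj_onI) (metis comp_assoc comp_id transpose_comp_involutory)
    ultimately show ?thesis
      using fin by (intro card_inj_on_le[of "\<lambda>p. p \<circ> ?s"]) auto
  qed
  have eq: "card (?A j) = card (?A i)" if "j < t" for j
    using le[OF i that] le[OF that i] by simp
  have "{p. p permutes {..<M}} = (\<Union>j<t. ?A j)"
  proof (intro equalityI subsetI)
    fix p assume p: "p \<in> {p. p permutes {..<M}}"
    obtain j where "j < t" "\<And>l. l < t \<Longrightarrow> p (ws ! l) \<le> p (ws ! j)"
    proof -
      have "Max ((\<lambda>j. p (ws ! j)) ` {..<t}) \<in> (\<lambda>j. p (ws ! j)) ` {..<t}"
        using i by (intro Max_in) auto
      then obtain j where j: "j < t" "p (ws ! j) = Max ((\<lambda>j. p (ws ! j)) ` {..<t})" by auto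
      show thesis by (rule that[OF j(1)]) (auto simp: j(2))
    qed
    then show "p \<in> (\<Union>j<t. ?A j)" using p unfolding max_at_def by blast
  qed auto
  then have "card {p. p permutes {..<M}} = card (\<Union>j<t. ?A j)" by simp
  also have "\<dots> = (\<Sum>j<t. card (?A j))"
    using fin max_at_unique[OF ws] by (intro card_UN_disjoint) (auto intro: finite_subset)
  also have "\<dots> = t * card (?A i)" using eq by simp
  finally show ?thesis by simp
qed

text \<open>Zero-based positions below \<open>k * s\<close> whose successor is not divisible by
  \<open>k\<close>, without the first and last \<open>k\<close> positions. The margins leave room
  for shifts by less than \<open>k\<close>.\<close>

definition good_positions :: "nat \<Rightarrow> nat \<Rightarrow> nat set" where
  "good_positions k s = (\<lambda>(a, b). k * a + b) ` ({1..<s - 1} \<times> {..<k - 1})"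

lemma card_good_positions: "card (good_positions k s) = (s - 2) * (k - 1)"
proof -
  have "inj_on (\<lambda>(a, b). k * a + b) ({1..<s - 1} \<times> {..<k - 1})"
  proof (rule inj_onI, clarify)
    fix a b a' b' assume *: "b < k - 1" "b' < k - 1" "k * a + b = k * a' + b'"
    have "b < k" "b' < k" using *(1,2) by linarith+
    then have "(k * a + b) div k = a" "(k * a' + b') div k = a'" by simp_all
    then show "a = a' \<and> b = b'" using * by simp
  qed
  then show ?thesis unfolding good_positions_def by (subst card_image) (simp_all add: numeral_2_eq_2)
qed

lemma good_positionsD:
  assumes "i \<in> good_positions k s" "k \<ge> 1"
  shows "k \<le> i" "i + k < k * s" "Suc i mod k \<noteq> 0"
proof -
  obtain a b where ab: "i = k * a + b" "1 \<le> a" "a < s - 1" "b < k - 1"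
    using assms(1) unfolding good_positions_def by auto
  have "k * 1 \<le> k * a" using ab by (intro mult_le_mono) auto
  then show "k \<le> i" unfolding ab(1) by linarith
  have "k * (a + 2) \<le> k * s" using ab by (intro mult_le_mono) auto
  then show "i + k < k * s" using ab by (simp add: algebra_simps)
  have "Suc i = k * a + Suc b" "Suc b < k" using ab by auto
  then show "Suc i mod k \<noteq> 0" by simp
qed

text \<open>The largest value inside a window moves one place to the left when the window is shifted,
  so some window of an edge shows it at a position divisible by \<open>k\<close>.\<close>

lemma window_edge_not_all_good:
  assumes xs: "xs \<in> increasing_lists M (k * s + k - 1)" and p: "p permutes {..<M}" and k: "k \<ge> 1"
    and good: "\<And>j. j < k \<Longrightarrow> \<exists>i\<in>good_positions k s. max_at (k * s) p (window (k * s) xs j) i"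
  shows False
proof -
  let ?t = "k * s"
  have len: "length xs = ?t + k - 1" using xs by (simp add: increasing_lists_def)
  have dist: "distinct xs" using xs by (simp add: increasing_lists_def strict_sorted_iff)
  obtain i where i: "\<And>j. j < k \<Longrightarrow> i j \<in> good_positions k s"
    "\<And>j. j < k \<Longrightarrow> max_at ?t p (window ?t xs j) (i j)" using good by metis
  note D = good_positionsD[OF i(1) k]
  \<comment> \<open>Because of the margins, the maxima of window \<open>0\<close> and window
    \<open>j\<close> both lie in the overlap of the two windows, so they are the same entry.\<close>
  have shift: "i j + j = i 0" if j: "j < k" for j
  proof -
    have 0: "0 < k" using k by simp
    have "p (window ?t xs 0 ! (i j + j)) \<le> p (window ?t xs 0 ! i 0)"
      using i(2)[OF 0] D(2)[OF j] j unfolding max_at_def by simp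
    moreover have "p (window ?t xs j ! (i 0 - j)) \<le> p (window ?t xs j ! i j)"
      using i(2)[OF j] D(2)[OF 0] unfolding max_at_def by simp
    moreover have "window ?t xs 0 ! (i j + j) = xs ! (i j + j)" "window ?t xs 0 ! i 0 = xs ! i 0"
      "window ?t xs j ! (i 0 - j) = xs ! i 0" "window ?t xs j ! i j = xs ! (i j + j)"
      using window_nth[OF 0 _ len, of "i j + j"] window_nth[OF 0 _ len, of "i 0"]
        window_nth[OF j _ len, of "i 0 - j"] window_nth[OF j _ len, of "i j"]
        D(1)[OF 0] D(2)[OF 0] D(2)[OF j] j by (simp_all add: add.commute)
    ultimately have "p (xs ! (i j + j)) = p (xs ! i 0)" by simp
    then have "xs ! (i j + j) = xs ! i 0" using permutes_inj[OF p] by (auto dest: injD)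
    then show ?thesis
      using nth_eq_iff_index_eq[OF dist, of "i j + j" "i 0"] len D(2)[OF 0] D(2)[OF j] j by simp
  qed
  \<comment> \<open>The shift that brings the successor of the position to a multiple of
    \<open>k\<close>.\<close>
  define j where "j = Suc (i 0) mod k"
  have j: "j < k" unfolding j_def using k by simp
  have "i 0 \<ge> k" using D(1)[of 0] k by simp
  then have "Suc (i j) = Suc (i 0) - j" using shift[OF j] j by simp
  then have "Suc (i j) mod k = 0" unfolding j_def by (simp add: minus_mod_eq_mult_div)
  then show False using D(3)[OF j] by simp
qed

text \<open>Averaging over all permutations: by \<open>card_max_at\<close> each \<open>y\<close> is
  kept with probability at least \<open>card G / t\<close>. Labels that are not increasing tuples
  are always kept.\<close>

lemma exists_good_permutation:
  fixes \<tau> :: "'a \<Rightarrow> nat list"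
  assumes Y: "finite Y" and G: "G \<subseteq> {..<t}"
  shows "\<exists>p. p permutes {..<M} \<and> card G * card Y \<le>
    t * card {y\<in>Y. \<tau> y \<in> increasing_lists M t \<longrightarrow> (\<exists>i\<in>G. max_at t p (\<tau> y) i)}"
proof (rule ccontr)
  let ?P = "{p. p permutes {..<M}}"
  let ?good = "\<lambda>p y. \<tau> y \<in> increasing_lists M t \<longrightarrow> (\<exists>i\<in>G. max_at t p (\<tau> y) i)"
  assume no: "\<not> ?thesis"
  have fin: "finite ?P" by (simp add: finite_permutations)
  have "id \<in> ?P" by (simp add: permutes_id)
  then have ne: "?P \<noteq> {}" by blast
  have finG: "finite G" using G finite_subset by blast
  have each: "card G * card ?P \<le> t * card {p\<in>?P. ?good p y}" for y
  proof (cases "\<tau> y \<in> increasing_lists M t")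
    case True
    let ?A = "\<lambda>i. {p. p permutes {..<M} \<and> max_at t p (\<tau> y) i}"
    have "\<forall>i\<in>G. finite (?A i)" using fin by simp
    moreover have "\<forall>i\<in>G. \<forall>j\<in>G. i \<noteq> j \<longrightarrow> ?A i \<inter> ?A j = {}"
    proof (intro ballI impI equals0I)
      fix i j p assume "i \<in> G" "j \<in> G" "i \<noteq> j" "p \<in> ?A i \<inter> ?A j"
      then show False using max_at_unique[OF True, of p i j] G by auto
    qed
    ultimately have "card (\<Union>i\<in>G. ?A i) = (\<Sum>i\<in>G. card (?A i))"
      by (rule card_UN_disjoint[OF finG])
    moreover have "{p\<in>?P. ?good p y} = (\<Union>i\<in>G. ?A i)" using True by auto
    ultimately have "card {p\<in>?P. ?good p y} = (\<Sum>i\<in>G. card (?A i))" by (simp only:)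
    then have "t * card {p\<in>?P. ?good p y} = (\<Sum>i\<in>G. card ?P)"
      using card_max_at[OF True] G by (simp only: sum_distrib_left) (rule sum.cong, auto)
    then show ?thesis by simp
  next
    case False
    then have "{p\<in>?P. ?good p y} = ?P" by blast
    moreover have "card G \<le> t" using card_mono[OF _ G] by simp
    ultimately show ?thesis by (simp only: mult_le_mono1)
  qed
  have "card ?P * (card G * card Y) = (\<Sum>y\<in>Y. card G * card ?P)" by simp
  also have "\<dots> \<le> (\<Sum>y\<in>Y. t * card {p\<in>?P. ?good p y})" by (intro sum_mono each)
  also have "\<dots> = t * (\<Sum>y\<in>Y. \<Sum>p\<in>?P. if ?good p y then 1 else 0)"
    using fin by (simp only: sum_distrib_left[symmetric]) (simp add: sum.If_cases Int_def)
  also have "(\<Sum>y\<in>Y. \<Sum>p\<in>?P. if ?good p y then 1 else (0::nat)) = (\<Sum>p\<in>?P. \<Sum>y\<in>Y. if ?good p y then 1 else 0)"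
    by (rule sum.swap)
  also have "t * \<dots> = (\<Sum>p\<in>?P. t * card {y\<in>Y. ?good p y})"
    using Y by (simp only: sum_distrib_left[symmetric]) (simp add: sum.If_cases Int_def)
  also have "\<dots> < (\<Sum>p\<in>?P. card G * card Y)"
    using no fin ne by (intro sum_strict_mono) (auto simp: not_le)
  also have "\<dots> = card ?P * (card G * card Y)" by simp
  finally show False by simp
qed

section \<open>Sparse Ramsey sets\<close>

lemma admissible_window_edges:
  assumes "k \<ge> 3" "t \<ge> 3"
  shows "admissible k (window_edges k t M)"
  unfolding admissible_def
proof (intro conjI impI allI notI ballI)
  show "card e = k" if "e \<in> window_edges k t M" for e
    using card_window_edge[OF that] assms by simp
  show False
    if "k = 3" "{v, a, b} \<in> window_edges k t M \<and> {v, a, c} \<in> window_edges k t M \<and> {v, b, c} \<in> window_edges k t M"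
    for v a b c
    using window_edges_no_K4_minus[OF assms(2), of v a b M c] that by simp
qed (fact assms)

text \<open>By separation a similar copy of \<open>F\<close> lies in one translate, by cardinality
  it is all of it, and each translate is labelled with the vertices of one edge.\<close>

lemma initial_picture:
  fixes F :: "(int ^ 'd) set"
  assumes F: "finite F" and k: "card F = k" "k \<ge> 3" and X: "finite X"
    and H: "H = (\<lambda>xs. \<omega> xs ` {..<k}) ` X"
  obtains P \<pi> where "finite P" "compatible F H P \<pi>"
    "\<And>xs. xs \<in> X \<Longrightarrow> \<exists>v. \<forall>f\<in>F. v + f \<in> P \<and> \<pi> (v + f) \<in> \<omega> xs ` {..<k}"
    "\<And>x. x \<in> P \<Longrightarrow> \<pi> x \<in> \<Union> H"
proof -
  obtain idx where idx: "bij_betw idx F {0..<k}" using ex_bij_betw_finite_nat[OF F] k(1) by blast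
  have idx_im: "idx ` F = {..<k}" using idx by (simp add: bij_betw_def atLeast0LessThan)
  obtain en where en: "bij_betw en {0..<card X} X" using ex_bij_betw_nat_finite[OF X] by blast
  have en_im: "en ` {..<card X} = X" using en by (simp add: bij_betw_def atLeast0LessThan)
  have k': "card F \<ge> 3" using k by simp
  obtain T where sep: "separating F (\<lambda>_. F) T"
    using separating_translations[OF F k', of "\<lambda>_. F"] F by blast
  have T: "i = j" if "x \<in> F" "y \<in> F" "T i + x = T j + y" for i j x y
    using sep that unfolding separating_def by blast
  have T': "\<exists>i. z ` F \<subseteq> (+) (T i) ` F" if "similar F z" "z ` F \<subseteq> (\<Union>i. (+) (T i) ` F)" for z
    using sep that unfolding separating_def by blast
  define P where "P = (\<Union>i<card X. (+) (T i) ` F)"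
  define \<pi> where "\<pi> y = (SOME u. \<exists>i<card X. \<exists>f\<in>F. y = T i + f \<and> u = \<omega> (en i) (idx f))" for y
  have pi: "\<pi> (T i + f) = \<omega> (en i) (idx f)" if "i < card X" "f \<in> F" for i f
    unfolding \<pi>_def
  proof (rule some_equality)
    show "\<exists>i'<card X. \<exists>f'\<in>F. T i + f = T i' + f' \<and> \<omega> (en i) (idx f) = \<omega> (en i') (idx f')"
      using that by blast
    fix u assume "\<exists>i'<card X. \<exists>f'\<in>F. T i + f = T i' + f' \<and> u = \<omega> (en i') (idx f')"
    then obtain i' f' where "f' \<in> F" "T i + f = T i' + f'" "u = \<omega> (en i') (idx f')" by blast
    then show "u = \<omega> (en i) (idx f)" using T[OF that(2), of f' i i'] by auto
  qed
  have edge: "\<omega> (en i) ` {..<k} \<in> H" if "i < card X" for i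
    unfolding H using en_im that by blast
  show thesis
  proof (rule that[of P \<pi>])
    show "finite P" unfolding P_def using F by simp
    show "compatible F H P \<pi>"
      unfolding compatible_def
    proof (intro allI impI)
      fix z assume z: "similar F z" "z ` F \<subseteq> P"
      have "P \<subseteq> (\<Union>i. (+) (T i) ` F)" unfolding P_def by blast
      then have "\<exists>i. z ` F \<subseteq> (+) (T i) ` F" using T'[OF z(1) order_trans[OF z(2)]] by simp
      then obtain i where i: "z ` F \<subseteq> (+) (T i) ` F" by (rule exE)
      have "F \<noteq> {}" using k by auto
      then obtain f where "f \<in> F" by blast
      then have "z f \<in> P" "z f \<in> (+) (T i) ` F" using z(2) i by blast+
      then obtain j f1 f2 where "j < card X" "f1 \<in> F" "f2 \<in> F" "T j + f1 = T i + f2"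
        unfolding P_def by auto
      then have in_X: "i < card X" using T[of f1 f2 j i] by simp
      have "card (z ` F) = card ((+) (T i) ` F)"
        using similar_inj[OF z(1)] by (simp add: card_image)
      then have "z ` F = (+) (T i) ` F" using i F by (intro card_subset_eq) simp_all
      then have "\<pi> ` z ` F = (\<lambda>f. \<omega> (en i) (idx f)) ` F"
        using pi[OF in_X] by (simp add: image_image)
      also have "\<dots> = \<omega> (en i) ` {..<k}" by (simp flip: idx_im add: image_image)
      finally show "\<pi> ` z ` F \<in> H" using edge[OF in_X] by simp
    qed
    show "\<exists>v. \<forall>f\<in>F. v + f \<in> P \<and> \<pi> (v + f) \<in> \<omega> xs ` {..<k}" if "xs \<in> X" for xs
    proof -
      have "xs \<in> en ` {..<card X}" using that en_im by simp
      then obtain i where i: "i < card X" "xs = en i" by auto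
      have "T i + f \<in> P \<and> \<pi> (T i + f) \<in> \<omega> xs ` {..<k}" if "f \<in> F" for f
      proof -
        have "idx f \<in> {..<k}" using that idx_im by blast
        then show ?thesis using pi[OF i(1) that] i that unfolding P_def by auto
      qed
      then show ?thesis by blast
    qed
    show "\<pi> x \<in> \<Union> H" if "x \<in> P" for x
    proof -
      have "x \<in> (\<Union>i<card X. (+) (T i) ` F)" using that unfolding P_def .
      then obtain i f where x: "i < card X" "f \<in> F" "x = T i + f" by auto
      have "idx f \<in> {..<k}" using x(2) idx_im by blast
      then show ?thesis using pi[OF x(1,2)] edge[OF x(1)] x(3) by blast
    qed
  qed
qed

lemma finite_ramsey_set:
  fixes F :: "(int ^ 'd) set"
  assumes F: "finite F" and k: "card F = k" "k \<ge> 3" and \<mu>: "\<mu> < (real k - 1) / real k" and r: "r \<ge> 1"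
  shows "\<exists>P. finite P \<and>
    (\<forall>col :: int ^ 'd \<Rightarrow> nat. (\<forall>x\<in>P. col x < r) \<longrightarrow>
      (\<exists>v lam c. lam > 0 \<and> (\<forall>f\<in>F. v + lam *s f \<in> P \<and> col (v + lam *s f) = c))) \<and>
    (\<forall>Y\<subseteq>P. \<exists>Z\<subseteq>Y. (\<forall>z. similar F z \<longrightarrow> \<not> z ` F \<subseteq> Z) \<and> \<mu> * real (card Y) \<le> real (card Z))"
proof -
  \<comment> \<open>The inequality \<open>2 * (k - 1) \<le> s * \<delta>\<close> says exactly that
    \<open>(s - 2) * (k - 1)\<close> good positions out of \<open>k * s\<close> have density at
    least \<open>\<mu>\<close>.\<close>
  define \<delta> where "\<delta> = real k - 1 - \<mu> * real k"
  have \<delta>: "\<delta> > 0" using \<mu> k(2) unfolding \<delta>_def by (simp add: field_simps)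
  obtain s0 :: nat where s0: "2 * (real k - 1) / \<delta> \<le> real s0" using real_arch_simple by blast
  define s where "s = s0 + 3"
  have s3: "s \<ge> 3" unfolding s_def by simp
  have "2 * (real k - 1) / \<delta> \<le> real s" using s0 unfolding s_def by simp
  then have "2 * (real k - 1) \<le> real s * \<delta>" using \<delta> by (simp add: field_simps)
  moreover have "real ((s - 2) * (k - 1)) = (real s - 2) * (real k - 1)"
    using s3 k(2) by (simp add: of_nat_diff)
  ultimately have density: "\<mu> * real (k * s) \<le> real ((s - 2) * (k - 1))"
    unfolding \<delta>_def by (simp add: algebra_simps)
  define t where "t = k * s"
  have t: "t \<ge> 3" "t > 0" using mult_le_mono[of 3 k 1 s] k(2) s3 unfolding t_def by simp_all
  have k1: "0 < k" "1 \<le> k" using k by simp_all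
  obtain M where M: "\<And>col. (\<forall>ws\<in>increasing_lists M t. col ws < r) \<Longrightarrow>
    \<exists>xs\<in>increasing_lists M (t + k - 1). \<exists>c::nat. \<forall>j<k. col (window t xs j) = c"
    using window_ramsey[of t r k] by blast
  define H where "H = window_edges k t M"
  have adm: "admissible (card F) H"
    unfolding H_def k(1) by (rule admissible_window_edges[OF k(2) t(1)])
  have H_W: "\<Union> H \<subseteq> increasing_lists M t"
    unfolding H_def window_edges_def using window_increasing by blast
  obtain P \<pi> where P: "finite P" "compatible F H P \<pi>"
    "\<And>xs. xs \<in> increasing_lists M (t + k - 1) \<Longrightarrow> \<exists>v. \<forall>f\<in>F. v + f \<in> P \<and> \<pi> (v + f) \<in> window t xs ` {..<k}"
    "\<And>x. x \<in> P \<Longrightarrow> \<pi> x \<in> \<Union> H"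
    using initial_picture[OF F k finite_increasing_lists H_def[unfolded window_edges_def]] by metis
  obtain Q \<rho> where Q: "finite Q" "compatible F H Q \<rho>" "part_ramsey r (increasing_lists M t) P \<pi> Q \<rho>"
    using partite_construction[OF F adm P(1,2) r finite_increasing_lists] by blast
  show ?thesis
  proof (rule exI[of _ Q], intro conjI allI impI)
    show "finite Q" by (fact Q(1))
    fix col :: "int ^ 'd \<Rightarrow> nat" assume col: "\<forall>x\<in>Q. col x < r"
    then obtain u lam where u: "lam > 0" "\<And>x. x \<in> P \<Longrightarrow> u + lam *s x \<in> Q"
      "\<And>x y. x \<in> P \<Longrightarrow> y \<in> P \<Longrightarrow> \<pi> x = \<pi> y \<Longrightarrow> \<pi> x \<in> increasing_lists M t \<Longrightarrow> col (u + lam *s x) = col (u + lam *s y)"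
      using Q(3) unfolding part_ramsey_def by blast
    \<comment> \<open>The colour of a vertex is the common colour of its class in the copy of
      \<open>P\<close>; vertices with empty class get the legal colour \<open>0\<close>.\<close>
    define wcol where "wcol ws = (if \<exists>x\<in>P. \<pi> x = ws then col (u + lam *s (SOME x. x \<in> P \<and> \<pi> x = ws)) else 0)" for ws
    have some: "(SOME x. x \<in> P \<and> \<pi> x = ws) \<in> P \<and> \<pi> (SOME x. x \<in> P \<and> \<pi> x = ws) = ws" if "\<exists>x\<in>P. \<pi> x = ws" for ws
      using that by (metis (mono_tags, lifting) someI_ex)
    have wcol: "wcol (\<pi> x) = col (u + lam *s x)" if "x \<in> P" for x
    proof -
      have ex: "\<exists>y\<in>P. \<pi> y = \<pi> x" using that by blast
      have "\<pi> x \<in> increasing_lists M t" using P(4)[OF that] H_W by blast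
      then show ?thesis
        unfolding wcol_def using ex some[OF ex] u(3)[of "SOME y. y \<in> P \<and> \<pi> y = \<pi> x" x] that by simp
    qed
    have "\<forall>ws\<in>increasing_lists M t. wcol ws < r"
    proof
      fix ws
      show "wcol ws < r"
        using some[of ws] u(2) col r unfolding wcol_def by (cases "\<exists>x\<in>P. \<pi> x = ws") auto
    qed
    from M[OF this] obtain xs c where xs: "xs \<in> increasing_lists M (t + k - 1)" "\<And>j. j < k \<Longrightarrow> wcol (window t xs j) = c"
      by blast
    obtain v where v: "\<And>f. f \<in> F \<Longrightarrow> v + f \<in> P" "\<And>f. f \<in> F \<Longrightarrow> \<pi> (v + f) \<in> window t xs ` {..<k}"
      using P(3)[OF xs(1)] by blast
    have expand: "u + lam *s (v + f) = (u + lam *s v) + lam *s f" for f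
      by (simp add: vec_eq_iff algebra_simps)
    have "u + lam *s (v + f) \<in> Q \<and> col (u + lam *s (v + f)) = c" if "f \<in> F" for f
      using u(2)[OF v(1)[OF that]] wcol[OF v(1)[OF that]] v(2)[OF that] xs(2) by auto
    then show "\<exists>v lam c. lam > 0 \<and> (\<forall>f\<in>F. v + lam *s f \<in> Q \<and> col (v + lam *s f) = c)"
      using u(1) unfolding expand by blast
  next
    fix Y assume YQ: "Y \<subseteq> Q"
    then have finY: "finite Y" using Q(1) finite_subset by blast
    have G: "good_positions k s \<subseteq> {..<t}"
      using good_positionsD(2)[OF _ k1(2)] unfolding t_def by fastforce
    obtain p where p: "p permutes {..<M}" "card (good_positions k s) * card Y \<le>
        t * card {y\<in>Y. \<rho> y \<in> increasing_lists M t \<longrightarrow> (\<exists>i\<in>good_positions k s. max_at t p (\<rho> y) i)}"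
      using exists_good_permutation[OF finY G] by blast
    \<comment> \<open>A similar copy inside \<open>Z\<close> would project onto an edge all of whose
      windows have their maximum at a good position.\<close>
    define Z where "Z = {y\<in>Y. \<rho> y \<in> increasing_lists M t \<longrightarrow> (\<exists>i\<in>good_positions k s. max_at t p (\<rho> y) i)}"
    have "\<not> z ` F \<subseteq> Z" if sim: "similar F z" for z
    proof
      assume sub: "z ` F \<subseteq> Z"
      then have "z ` F \<subseteq> Q" using YQ unfolding Z_def by blast
      then have "\<rho> ` z ` F \<in> H" using Q(2) sim unfolding compatible_def by blast
      then obtain xs where xs: "xs \<in> increasing_lists M (t + k - 1)" "\<rho> ` z ` F = window t xs ` {..<k}"
        unfolding H_def window_edges_def by blast
      have "\<exists>i\<in>good_positions k s. max_at t p (window t xs j) i" if "j < k" for j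
      proof -
        have "window t xs j \<in> \<rho> ` z ` F" using that xs(2) by blast
        then obtain y where "y \<in> Z" "\<rho> y = window t xs j" using sub by auto
        then show ?thesis using window_increasing[OF xs(1) that] unfolding Z_def by auto
      qed
      then show False
        using window_edge_not_all_good[of xs M k s p] xs(1) p(1) k1(2) unfolding t_def by blast
    qed
    moreover have "\<mu> * real (card Y) \<le> real (card Z)"
    proof -
      have "real t * (\<mu> * real (card Y)) = (\<mu> * real (k * s)) * real (card Y)" unfolding t_def by simp
      also have "\<dots> \<le> real ((s - 2) * (k - 1)) * real (card Y)"
        by (rule mult_right_mono[OF density]) simp
      also have "\<dots> = real (card (good_positions k s) * card Y)"
        by (simp only: card_good_positions of_nat_mult)
      also have "\<dots> \<le> real (t * card Z)"
        using p(2) unfolding Z_def by (simp only: of_nat_le_iff)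
      finally show ?thesis using t(2) by (simp add: mult_le_cancel_left_pos)
    qed
    moreover have "Z \<subseteq> Y" unfolding Z_def by blast
    ultimately show "\<exists>Z\<subseteq>Y. (\<forall>z. similar F z \<longrightarrow> \<not> z ` F \<subseteq> Z) \<and> \<mu> * real (card Y) \<le> real (card Z)"
      by blast
  qed
qed

section \<open>Real isometries and the infinite set\<close>

lemma nsq_lattice: "(norm (lattice_to_real x - lattice_to_real y))\<^sup>2 = real_of_int (nsq (x - y))"
  by (simp add: lattice_to_real_def ip_def norm_vec_def L2_set_def sum_nonneg power2_eq_square)

text \<open>An isometric image of \<open>lam\<close> times \<open>F\<close> on lattice points
  multiplies squared distances by the square of \<open>lam\<close>, hence comes from a map that is
  \<open>similar\<close>.\<close>

lemma F_free_if_no_similar: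
  assumes no: "\<And>z. similar F z \<Longrightarrow> \<not> z ` F \<subseteq> Z"
  shows "F_free F Z"
  unfolding F_free_def
proof (intro notI, elim exE conjE)
  fix lam :: real and g
  assume lam: "lam \<noteq> 0" and g: "euclid_isometry g"
    and sub: "(\<lambda>f. g (lam *\<^sub>R lattice_to_real f)) ` F \<subseteq> lattice_to_real ` Z"
  have "\<forall>f\<in>F. \<exists>x\<in>Z. g (lam *\<^sub>R lattice_to_real f) = lattice_to_real x"
    using sub by (auto simp: image_subset_iff)
  then obtain z where z: "\<And>f. f \<in> F \<Longrightarrow> z f \<in> Z" "\<And>f. f \<in> F \<Longrightarrow> g (lam *\<^sub>R lattice_to_real f) = lattice_to_real (z f)"
    by metis
  have "real_of_int (nsq (z f - z h)) = lam\<^sup>2 * real_of_int (nsq (f - h))" if "f \<in> F" "h \<in> F" for f h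
  proof -
    have "real_of_int (nsq (z f - z h)) = (dist (g (lam *\<^sub>R lattice_to_real f)) (g (lam *\<^sub>R lattice_to_real h)))\<^sup>2"
      unfolding z(2)[OF that(1)] z(2)[OF that(2)] dist_norm by (rule nsq_lattice[symmetric])
    also have "\<dots> = (norm (lam *\<^sub>R (lattice_to_real f - lattice_to_real h)))\<^sup>2"
      using g by (simp add: euclid_isometry_def dist_norm scaleR_diff_right)
    also have "\<dots> = lam\<^sup>2 * real_of_int (nsq (f - h))"
      by (simp add: power_mult_distrib nsq_lattice)
    finally show ?thesis .
  qed
  moreover have "lam\<^sup>2 > 0" using lam by simp
  ultimately have "similar F z" unfolding similar_def by blast
  then show False using no z(1) by blast
qed

text \<open>\<open>X\<close> is a union of far apart translates of finite sets, the one with index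
  \<open>n\<close> serving \<open>Suc n\<close> colours. Similar copies stay inside one translate,
  so sparse subsets are chosen in each translate separately and their sizes add up.\<close>

theorem theorem1p5:
  fixes F :: "(int ^ 'd) set" and k :: nat and \<mu> :: real
  assumes "finite F" and "card F = k" and "k \<ge> 3"
    and "0 < \<mu>" and "\<mu> < (real k - 1) / real k"
  shows "\<exists>X :: (int ^ 'd) set. (\<forall>x\<in>X. \<forall>i. x $ i \<ge> 0) \<and>
    (\<forall>r::nat. r \<ge> 1 \<longrightarrow> (\<forall>c :: int ^ 'd \<Rightarrow> nat. (\<forall>x\<in>X. c x < r) \<longrightarrow>
        (\<exists>v lam col. lam > 0 \<and> homothetic_copy v lam F \<subseteq> X \<and>
            (\<forall>y\<in>homothetic_copy v lam F. c y = col)))) \<and>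
    (\<forall>Y. finite Y \<and> Y \<subseteq> X \<longrightarrow>
        (\<exists>Z. Z \<subseteq> Y \<and> F_free F Z \<and> real (card Z) \<ge> \<mu> * real (card Y)))"
proof -
  have "\<exists>P. finite P \<and>
    (\<forall>col :: int ^ 'd \<Rightarrow> nat. (\<forall>x\<in>P. col x < Suc n) \<longrightarrow>
      (\<exists>v lam c. lam > 0 \<and> (\<forall>f\<in>F. v + lam *s f \<in> P \<and> col (v + lam *s f) = c))) \<and>
    (\<forall>Y\<subseteq>P. \<exists>Z\<subseteq>Y. (\<forall>z. similar F z \<longrightarrow> \<not> z ` F \<subseteq> Z) \<and> \<mu> * real (card Y) \<le> real (card Z))" for n
    by (rule finite_ramsey_set[OF assms(1-3,5)]) simp
  then obtain P where P: "\<And>n. finite (P n)"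
    and ramsey: "\<And>n (col :: int ^ 'd \<Rightarrow> nat). (\<forall>x\<in>P n. col x < Suc n) \<Longrightarrow>
      \<exists>v lam c. lam > 0 \<and> (\<forall>f\<in>F. v + lam *s f \<in> P n \<and> col (v + lam *s f) = c)"
    and free: "\<And>n Y. Y \<subseteq> P n \<Longrightarrow>
      \<exists>Z\<subseteq>Y. (\<forall>z. similar F z \<longrightarrow> \<not> z ` F \<subseteq> Z) \<and> \<mu> * real (card Y) \<le> real (card Z)"
    by metis
  have F3: "card F \<ge> 3" using assms by simp
  obtain T where sep: "separating F P T"
    using separating_translations[where S=P, OF assms(1) F3 P] by (rule exE)
  have T: "(T n + x) $ c \<ge> 0" if "x \<in> P n" for n x c
    using sep that unfolding separating_def by blast
  have T': "i = j" if "x \<in> P i" "y \<in> P j" "T i + x = T j + y" for i j x y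
    using sep that unfolding separating_def by blast
  have T'': "\<exists>i. z ` F \<subseteq> (+) (T i) ` P i" if "similar F z" "z ` F \<subseteq> (\<Union>i. (+) (T i) ` P i)" for z
    using sep that unfolding separating_def by blast
  let ?B = "\<lambda>n. (+) (T n) ` P n"
  define X where "X = (\<Union>n. ?B n)"
  have hom: "homothetic_copy v lam F = (\<lambda>f. v + lam *s f) ` F" for v lam
    unfolding homothetic_copy_def by (rule image_cong) (simp_all add: vec_eq_iff)
  have disj: "m = n" if "x \<in> ?B m" "x \<in> ?B n" for x m n
    using that T' by blast
  show ?thesis
  proof (rule exI[of _ X], intro conjI ballI allI impI)
    show "x $ i \<ge> 0" if "x \<in> X" for x i
      using that T unfolding X_def by blast
  next
    fix r :: nat and c :: "int ^ 'd \<Rightarrow> nat"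
    assume r: "r \<ge> 1" and c: "\<forall>x\<in>X. c x < r"
    obtain n where n: "r = Suc n" using r by (cases r) auto
    have "\<forall>x\<in>P n. c (T n + x) < Suc n" using c n unfolding X_def by blast
    from ramsey[of n "\<lambda>x. c (T n + x)", OF this] obtain v lam col where *: "lam > 0"
      "\<And>f. f \<in> F \<Longrightarrow> v + lam *s f \<in> P n" "\<And>f. f \<in> F \<Longrightarrow> c (T n + (v + lam *s f)) = col" by blast
    have "homothetic_copy (T n + v) lam F = (\<lambda>f. T n + (v + lam *s f)) ` F"
      unfolding hom by (simp add: add.assoc)
    then have "homothetic_copy (T n + v) lam F \<subseteq> X \<and> (\<forall>y\<in>homothetic_copy (T n + v) lam F. c y = col)"
      using *(2,3) unfolding X_def by auto
    then show "\<exists>v lam col. lam > 0 \<and> homothetic_copy v lam F \<subseteq> X \<and> (\<forall>y\<in>homothetic_copy v lam F. c y = col)"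
      using *(1) by blast
  next
    fix Y assume "finite Y \<and> Y \<subseteq> X"
    then have Y: "finite Y" "Y \<subseteq> X" by blast+
    define Yn where "Yn n = {x\<in>P n. T n + x \<in> Y}" for n
    have "\<exists>Z\<subseteq>Yn n. (\<forall>z. similar F z \<longrightarrow> \<not> z ` F \<subseteq> Z) \<and> \<mu> * real (card (Yn n)) \<le> real (card Z)" for n
      by (rule free) (auto simp: Yn_def)
    then obtain Zn where Zn: "\<And>n. Zn n \<subseteq> Yn n" "\<And>n z. similar F z \<Longrightarrow> \<not> z ` F \<subseteq> Zn n"
      "\<And>n. \<mu> * real (card (Yn n)) \<le> real (card (Zn n))" by metis
    define Z where "Z = (\<Union>n. (+) (T n) ` Zn n)"
    have ZY: "Z \<subseteq> Y" using Zn(1) unfolding Z_def Yn_def by blast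
    have ZB: "(+) (T n) ` Zn n \<subseteq> ?B n" for n using Zn(1)[of n] unfolding Yn_def by blast
    have "F_free F Z"
    proof (rule F_free_if_no_similar, rule notI)
      fix z assume z: "similar F z" "z ` F \<subseteq> Z"
      have "Z \<subseteq> (\<Union>n. ?B n)" using ZB unfolding Z_def by blast
      then have "\<exists>n. z ` F \<subseteq> ?B n" using T''[OF z(1) order_trans[OF z(2)]] by simp
      then obtain n where n: "z ` F \<subseteq> ?B n" by (rule exE)
      have "z ` F \<subseteq> (+) (T n) ` Zn n"
      proof
        fix y assume y: "y \<in> z ` F"
        then obtain m where m: "y \<in> (+) (T m) ` Zn m" using z(2) unfolding Z_def by blast
        then have "m = n" using disj[of y m n] ZB[of m] n y by blast
        then show "y \<in> (+) (T n) ` Zn n" using m by simp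
      qed
      then have "(\<lambda>f. z f - T n) ` F \<subseteq> Zn n" by auto
      moreover have "similar F (\<lambda>f. z f - T n)" using z(1) unfolding similar_def by simp
      ultimately show False using Zn(2) by blast
    qed
    moreover have "\<mu> * real (card Y) \<le> real (card Z)"
    proof -
      \<comment> \<open>Finite because disjoint blocks with points of \<open>Y\<close> contain
        different points of the finite set \<open>Y\<close>.\<close>
      define N where "N = {n. Yn n \<noteq> {}}"
      have "\<forall>y\<in>Y. \<exists>n. y \<in> ?B n" using Y(2) unfolding X_def by blast
      then obtain blk where blk: "\<And>y. y \<in> Y \<Longrightarrow> y \<in> ?B (blk y)" by metis
      have "N \<subseteq> blk ` Y"
      proof
        fix n assume "n \<in> N"
        then obtain x where "x \<in> P n" "T n + x \<in> Y" unfolding N_def Yn_def by blast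
        then show "n \<in> blk ` Y" using blk disj by blast
      qed
      then have finN: "finite N" using Y(1) finite_surj by blast
      have finYn: "finite (Yn n)" for n
        using P[of n] unfolding Yn_def by simp
      have card_UN: "card (\<Union>n\<in>N. (+) (T n) ` W n) = (\<Sum>n\<in>N. card (W n))"
        if W: "\<And>n. W n \<subseteq> Yn n" for W
      proof -
        have "card (\<Union>n\<in>N. (+) (T n) ` W n) = (\<Sum>n\<in>N. card ((+) (T n) ` W n))"
        proof (rule card_UN_disjoint[OF finN])
          show "\<forall>n\<in>N. finite ((+) (T n) ` W n)" using finite_subset[OF W finYn] by blast
          have WB: "(+) (T n) ` W n \<subseteq> ?B n" for n using W[of n] unfolding Yn_def by blast
          show "\<forall>m\<in>N. \<forall>n\<in>N. m \<noteq> n \<longrightarrow> (+) (T m) ` W m \<inter> (+) (T n) ` W n = {}"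
          proof (intro ballI impI equals0I)
            fix m n y assume "m \<noteq> n" "y \<in> (+) (T m) ` W m \<inter> (+) (T n) ` W n"
            then show False using disj[of y m n] subsetD[OF WB[of m], of y] subsetD[OF WB[of n], of y] by simp
          qed
        qed
        also have "\<dots> = (\<Sum>n\<in>N. card (W n))" by (intro sum.cong) (simp_all add: card_image)
        finally show ?thesis .
      qed
      have "Y = (\<Union>n\<in>N. (+) (T n) ` Yn n)"
        using Y(2) unfolding X_def N_def Yn_def by blast
      then have cY: "card Y = (\<Sum>n\<in>N. card (Yn n))" using card_UN[of Yn] by simp
      have "Z = (\<Union>n\<in>N. (+) (T n) ` Zn n)"
        using Zn(1) unfolding Z_def N_def by blast
      then have cZ: "card Z = (\<Sum>n\<in>N. card (Zn n))" using card_UN[of Zn] Zn(1) by simp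
      have "\<mu> * real (card Y) = (\<Sum>n\<in>N. \<mu> * real (card (Yn n)))"
        unfolding cY by (simp add: sum_distrib_left)
      also have "\<dots> \<le> (\<Sum>n\<in>N. real (card (Zn n)))" by (intro sum_mono Zn(3))
      also have "\<dots> = real (card Z)" unfolding cZ by simp
      finally show ?thesis .
    qed
    ultimately show "\<exists>Z. Z \<subseteq> Y \<and> F_free F Z \<and> real (card Z) \<ge> \<mu> * real (card Y)"
      using ZY by blast
  qed
qed

end
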